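(* Let $(x_i,y_j)\notin\partial\Omega$ be a regular grid point and take the base point $(x_i^*,y_j^* )=(x_i,y_j)$. Consider the 9-point compact scheme centered at $(x_i,y_j)$ $$h^{-2}\mathcal{L}_h u_h:=h^{-2}\sum_{k=-1}^{1}\sum_{\ell=-1}^{1}C_{k,\ell}\,(u_h)_{i+k,j+\ell}=h^{-2}\sum_{(m,n)\in\Lambda_5}f^{(m,n)}\sum_{k=-1}^{1}\sum_{\ell=-1}^{1}C_{k,\ell}H_{7,m,n}(kh,\ell h),$$ where $C_{k,\ell}:=\sum_{p=0}^{7}c_{k,\ell,p}h^p$ and $\{c_{k,\ell,p}\}_{-1\le k,\ell\le 1,\,0\le p\le 7}\subset\mathbb{R}$ is any nontrivial solution of the linear system $$\sum_{k=-1}^{1}\sum_{\ell=-1}^{1}c_{k,\ell,d}\,G_{m,n}(k,\ell)=-\sum_{k=-1}^{1}\sum_{\ell=-1}^{1}\sum_{s=0}^{d-1}c_{k,\ell,s}\sum_{\substack{(p,q)\in\Lambda_7^2\setminus\Lambda_{m+n}^2\\ p+q=m+n+d-s}}\frac{a^u_{p,q,m,n}}{p!\,q!}k^p\ell^q\qquad\text{for all }(m,n)\in\Lambda_{7-d}^1,\ d=0,1,\ldots,7$$ (the sum over $s$ is empty for $d=0$). Then this scheme achieves the sixth-order consistency for $-\nabla\cdot(a\nabla u)=f$ at $(x_i,y_j)$. Moreover, this linear system for the unknowns $\{c_{k,\ell,p}\}_{-1\le k,\ell\le 1,\,0\le p\le 7}$ always has nontrivial solutions, and: (i) every nontrivial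 solution satisfies the sum condition $\sum_{k=-1}^{1}\sum_{\ell=-1}^{1}C_{k,\ell}\ge 0$ for every mesh size $h>0$; (ii) there exists a nontrivial solution such that $\{C_{k,\ell}\}_{k,\ell=-1,0,1}$ satisfies the sign condition $C_{0,0}>0$ and $C_{k,\ell}\le 0$ for all $(k,\ell)\ne(0,0)$, for every mesh size $h>0$.
   Context: **Problem.** $\Omega=(l_1,l_2)\times(l_3,l_4)$ with $l_4-l_3=N_0(l_2-l_1)$, $N_0\in\mathbb{N}$; $\psi$ is a smooth two-variable function, $\Gamma=\{(x,y)\in\Omega:\psi(x,y)=0\}$ is a smooth curve, $\Omega_+=\{(x,y)\in\Omega:\psi>0\}$, $\Omega_-=\{(x,y)\in\Omega:\psi<0\}$. The function $u$ satisfies $-\nabla\cdot(a\nabla u)=f$ in $\Omega\setminus\Gamma$ with a scalar variable coefficient $a>0$. In each of $\Omega_+$ and $\Omega_-$, $a$ has uniformly continuous partial derivatives of total order up to six, $u$ up to seven and $f$ up to five; all may be discontinuous across $\Gamma$. **Grid.** For $N_1\in\mathbb{N}$, $h=(l_2-l_1)/N_1$, $x_i=l_1+ih$ ($0\le i\le N_1$), $y_j=l_3+jh$ ($0\le j\le N_0N_1$). $(u_h)_{i,j}$ is the numerical approximation of $u(x_i,y_j)$. A grid point $(x_i,y_j)$ is regular if the nine points $(x_i+kh,y_j+\ell h)$, $k,\ell\in\{-1,0,1\}$, either all satisfy $\psi>0$ or all satisfy $\psi\le 0$. All functions below are those of the side containing the nine points. **Notation.** $a^{(m,n)},u^{(m,n)},f^{(m,n)}$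 denote the partial derivatives $\partial_x^m\partial_y^n$ of $a,u,f$ at the base point $(x_i^*,y_j^* )$; similarly for $(1/a)^{(m,n)}$, $(a_x/a)^{(m,n)}$, $(a_y/a)^{(m,n)}$. With $\mathbb{N}_0=\mathbb{N}\cup\{0\}$, $$\Lambda_K=\{(m,n)\in\mathbb{N}_0^2: m+n\le K\},\quad \Lambda_K^1=\{(m,n)\in\Lambda_K: m\in\{0,1\}\},\quad \Lambda_K^2=\Lambda_K\setminus\Lambda_K^1.$$ **Coefficients $a^u$, $a^f$.** These are the coefficients in $u^{(p,q)}=\sum_{(m,n)\in\Lambda_{p+q}^1}a^u_{p,q,m,n}u^{(m,n)}+\sum_{(m,n)\in\Lambda_{p+q-2}}a^f_{p,q,m,n}f^{(m,n)}$ obtained by repeatedly using the differentiated equation. Explicitly: if $p\in\{0,1\}$, then $a^u_{p,q,m,n}=1$ when $(m,n)=(p,q)$ and $0$ otherwise, and $a^f_{p,q,m,n}=0$; for $p\ge 2$, recursively in $p$, both $w=a^u_{\cdot,\cdot,m,n}$ and $w=a^f_{\cdot,\cdot,m,n}$ satisfy $$w_{p,q}=-\epsilon_{p,q}-w_{p-2,q+2}-\sum_{\mathsf i=0}^{p-2}\sum_{\mathsf j=0}^{q}\binom{p-2}{\mathsf i}\binom{q}{\mathsf j}\Big[\big(\tfrac{a_x}{a}\big)^{(p-2-\mathsf i,\,q-\mathsf j)}w_{\mathsf i+1,\mathsf j}+\big(\tfrac{a_y}{a}\big)^{(p-2-\mathsf i,\,q-\mathsf j)}w_{\mathsf i,\mathsf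 j+1}\Big],$$ with $\epsilon_{p,q}=0$ for $a^u$, and for $a^f$, $\epsilon_{p,q}=\binom{p-2}{m}\binom{q}{n}(1/a)^{(p-2-m,q-n)}$ if $m\le p-2$ and $n\le q$, and $0$ otherwise. **Polynomials.** $$G_{m,n}(x,y)=\sum_{\ell=0}^{\lfloor n/2\rfloor}\frac{(-1)^\ell x^{m+2\ell}y^{n-2\ell}}{(m+2\ell)!(n-2\ell)!},\qquad H_{7,m,n}(x,y)=\sum_{(p,q)\in\Lambda_7^2}\frac{a^f_{p,q,m,n}}{p!\,q!}x^py^q.$$ Convention $0^0=1$. **Taylor expansion.** The exact solution is taken to satisfy $u(x+x_i^*,y+y_j^* )=\sum_{(m,n)\in\Lambda_7}u^{(m,n)}\frac{x^my^n}{m!n!}+\mathcal{O}(h^8)$ for $x,y\in(-2h,2h)$ (at the stencil points). **Terminology.** "Nontrivial" means $c_{k,\ell,0}\ne 0$ for at least one $(k,\ell)$. "Sixth-order consistency" means that replacing $(u_h)_{i+k,j+\ell}$ by the exact values $u(x_i+kh,y_j+\ell h)$, the difference between the left-hand and right-hand sides of the scheme is $\mathcal{O}(h^6)$ as $h\to0$ (with the $c_{k,\ell,p}$ fixed). *)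

theory Defs
  imports "HOL-Analysis.Analysis" "HOL-Library.Landau_Symbols"
begin

section \<open>Partial derivatives and regularity\<close>

definition partial_x :: "(real \<times> real \<Rightarrow> real) \<Rightarrow> real \<times> real \<Rightarrow> real" where
  "partial_x g = (\<lambda>(x, y). deriv (\<lambda>t. g (t, y)) x)"

definition partial_y :: "(real \<times> real \<Rightarrow> real) \<Rightarrow> real \<times> real \<Rightarrow> real" where
  "partial_y g = (\<lambda>(x, y). deriv (\<lambda>t. g (x, t)) y)"

definition mixed_partial :: "nat \<Rightarrow> nat \<Rightarrow> (real \<times> real \<Rightarrow> real) \<Rightarrow> real \<times> real \<Rightarrow> real" where
  "mixed_partial m n g = (partial_x ^^ m) ((partial_y ^^ n) g)"

text \<open>All partial derivatives of total order at most \<open>K\<close>, taken in any order of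
  differentiation, exist on \<open>S\<close> and have property \<open>Q\<close>. It is used for open \<open>S\<close> only.\<close>

primrec partials_upto ::
  "((real \<times> real \<Rightarrow> real) \<Rightarrow> bool) \<Rightarrow> nat \<Rightarrow> (real \<times> real) set \<Rightarrow> (real \<times> real \<Rightarrow> real) \<Rightarrow> bool"
where
  "partials_upto Q 0 S g \<longleftrightarrow> Q g"
| "partials_upto Q (Suc K) S g \<longleftrightarrow>
     Q g \<and>
     (\<forall>(x, y)\<in>S. (\<lambda>t. g (t, y)) differentiable (at x) \<and> (\<lambda>t. g (x, t)) differentiable (at y)) \<and>
     partials_upto Q K S (partial_x g) \<and> partials_upto Q K S (partial_y g)"

abbreviation uc_partials :: "nat \<Rightarrow> (real \<times> real) set \<Rightarrow> (real \<times> real \<Rightarrow> real) \<Rightarrow> bool" where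
  "uc_partials K S \<equiv> partials_upto (uniformly_continuous_on S) K S"

definition smooth2 :: "(real \<times> real \<Rightarrow> real) \<Rightarrow> bool" where
  "smooth2 g \<longleftrightarrow> (\<forall>K. partials_upto (continuous_on UNIV) K UNIV g)"

text \<open>An embedded curve: locally the homeomorphic image of an open interval under a
  \<open>C\<^sup>\<infinity>\<close> parametrization with nonvanishing velocity.\<close>

definition smooth_curve :: "(real \<times> real) set \<Rightarrow> bool" where
  "smooth_curve C \<longleftrightarrow>
     (\<forall>p\<in>C. \<exists>U \<gamma> \<delta>. open U \<and> p \<in> U \<and> homeomorphism {-1<..<1::real} (C \<inter> U) \<gamma> \<delta> \<and>
        (\<forall>n. ((\<lambda>g t. vector_derivative g (at t)) ^^ n) \<gamma> differentiable_on {-1<..<1}) \<and>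
        (\<forall>t\<in>{-1<..<1}. vector_derivative \<gamma> (at t) \<noteq> 0))"


section \<open>The interface problem\<close>

definition rect :: "real \<Rightarrow> real \<Rightarrow> real \<Rightarrow> real \<Rightarrow> (real \<times> real) set" where
  "rect l1 l2 l3 l4 = {l1<..<l2} \<times> {l3<..<l4}"

definition interface :: "(real \<times> real) set \<Rightarrow> (real \<times> real \<Rightarrow> real) \<Rightarrow> (real \<times> real) set" where
  "interface \<Omega> \<psi> = {p\<in>\<Omega>. \<psi> p = 0}"

datatype side = Plus | Minus

fun subdomain :: "(real \<times> real) set \<Rightarrow> (real \<times> real \<Rightarrow> real) \<Rightarrow> side \<Rightarrow> (real \<times> real) set" where
  "subdomain \<Omega> \<psi> Plus = {p\<in>\<Omega>. \<psi> p > 0}"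
| "subdomain \<Omega> \<psi> Minus = {p\<in>\<Omega>. \<psi> p < 0}"

text \<open>For grid points the points of the curve are counted with the minus side.\<close>

fun on_side :: "(real \<times> real \<Rightarrow> real) \<Rightarrow> side \<Rightarrow> real \<times> real \<Rightarrow> bool" where
  "on_side \<psi> Plus p \<longleftrightarrow> \<psi> p > 0"
| "on_side \<psi> Minus p \<longleftrightarrow> \<psi> p \<le> 0"

definition elliptic_op ::
  "(real \<times> real \<Rightarrow> real) \<Rightarrow> (real \<times> real \<Rightarrow> real) \<Rightarrow> real \<times> real \<Rightarrow> real" where
  "elliptic_op a u p =
     - (partial_x (\<lambda>q. a q * partial_x u q) p + partial_y (\<lambda>q. a q * partial_y u q) p)"

text \<open>The value at \<open>p\<close> of ``the function of the side \<open>S\<close>''. A regular grid point may lie on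
  the curve; there, functions and derivatives are the continuous extensions from \<open>S\<close>.\<close>

definition one_sided :: "(real \<times> real) set \<Rightarrow> (real \<times> real \<Rightarrow> real) \<Rightarrow> real \<times> real \<Rightarrow> real" where
  "one_sided S g p = (if p \<in> S then g p else Lim (at p within S) g)"

text \<open>The numbers \<open>g\<^sup>(\<^sup>m\<^sup>,\<^sup>n\<^sup>)\<close> at the base point \<open>z\<close>.\<close>

definition jet ::
  "(real \<times> real) set \<Rightarrow> real \<times> real \<Rightarrow> (real \<times> real \<Rightarrow> real) \<Rightarrow> nat \<Rightarrow> nat \<Rightarrow> real" where
  "jet S z g m n = one_sided S (mixed_partial m n g) z"


section \<open>Grid\<close>

definition stencil_pt :: "real \<times> real \<Rightarrow> real \<Rightarrow> int \<Rightarrow> int \<Rightarrow> real \<times> real" where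
  "stencil_pt z h k l = (fst z + of_int k * h, snd z + of_int l * h)"

text \<open>The base point \<open>z\<close> is regular for mesh size \<open>h\<close>, with its nine points on side \<open>s\<close>;
  thus regularity is the existence of such an \<open>s\<close>.\<close>

definition regular_on_side ::
  "(real \<times> real \<Rightarrow> real) \<Rightarrow> side \<Rightarrow> real \<times> real \<Rightarrow> real \<Rightarrow> bool" where
  "regular_on_side \<psi> s z h \<longleftrightarrow> (\<forall>k\<in>{-1..1}. \<forall>l\<in>{-1..1}. on_side \<psi> s (stencil_pt z h k l))"


section \<open>Index sets, coefficients and polynomials\<close>

definition Lam :: "nat \<Rightarrow> (nat \<times> nat) set" where
  "Lam K = {(m, n). m + n \<le> K}"

definition Lam1 :: "nat \<Rightarrow> (nat \<times> nat) set" where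
  "Lam1 K = {(m, n)\<in>Lam K. m \<in> {0, 1}}"

definition Lam2 :: "nat \<Rightarrow> (nat \<times> nat) set" where
  "Lam2 K = Lam K - Lam1 K"

text \<open>The common recursion in \<open>p\<close>: \<open>rx\<close>, \<open>ry\<close> are the jets of \<open>a\<^sub>x/a\<close>, \<open>a\<^sub>y/a\<close>; \<open>ini\<close> gives
  the values for \<open>p \<le> 1\<close>, and \<open>eps\<close> is the inhomogeneity.\<close>

fun elim_rec ::
  "(nat \<Rightarrow> nat \<Rightarrow> real) \<Rightarrow> (nat \<Rightarrow> nat \<Rightarrow> real) \<Rightarrow> (nat \<Rightarrow> nat \<Rightarrow> real) \<Rightarrow> (nat \<Rightarrow> nat \<Rightarrow> real) \<Rightarrow>
   nat \<Rightarrow> nat \<Rightarrow> real" where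
  "elim_rec rx ry ini eps 0 q = ini 0 q"
| "elim_rec rx ry ini eps (Suc 0) q = ini 1 q"
| "elim_rec rx ry ini eps (Suc (Suc p)) q =
     - eps (Suc (Suc p)) q - elim_rec rx ry ini eps p (q + 2)
     - (\<Sum>i\<in>{0..p}. \<Sum>j\<in>{0..q}. of_nat (p choose i) * of_nat (q choose j) *
          (rx (p - i) (q - j) * elim_rec rx ry ini eps (i + 1) j +
           ry (p - i) (q - j) * elim_rec rx ry ini eps i (j + 1)))"

definition coef_u ::
  "(real \<times> real) set \<Rightarrow> (real \<times> real \<Rightarrow> real) \<Rightarrow> real \<times> real \<Rightarrow> nat \<Rightarrow> nat \<Rightarrow> nat \<Rightarrow> nat \<Rightarrow> real" where
  "coef_u S a z p q m n =
     elim_rec (jet S z (\<lambda>w. partial_x a w / a w)) (jet S z (\<lambda>w. partial_y a w / a w))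
       (\<lambda>p q. if (m, n) = (p, q) then 1 else 0) (\<lambda>p q. 0) p q"

definition coef_f ::
  "(real \<times> real) set \<Rightarrow> (real \<times> real \<Rightarrow> real) \<Rightarrow> real \<times> real \<Rightarrow> nat \<Rightarrow> nat \<Rightarrow> nat \<Rightarrow> nat \<Rightarrow> real" where
  "coef_f S a z p q m n =
     elim_rec (jet S z (\<lambda>w. partial_x a w / a w)) (jet S z (\<lambda>w. partial_y a w / a w))
       (\<lambda>p q. 0)
       (\<lambda>p q. if m + 2 \<le> p \<and> n \<le> q
              then of_nat ((p - 2) choose m) * of_nat (q choose n) *
                   jet S z (\<lambda>w. 1 / a w) (p - 2 - m) (q - n)
              else 0) p q"

definition G_poly :: "nat \<Rightarrow> nat \<Rightarrow> real \<Rightarrow> real \<Rightarrow> real" where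
  "G_poly m n x y =
     (\<Sum>l\<in>{0..n div 2}. (-1) ^ l * x ^ (m + 2 * l) * y ^ (n - 2 * l) /
        (fact (m + 2 * l) * fact (n - 2 * l)))"

definition H7_poly ::
  "(real \<times> real) set \<Rightarrow> (real \<times> real \<Rightarrow> real) \<Rightarrow> real \<times> real \<Rightarrow> nat \<Rightarrow> nat \<Rightarrow> real \<Rightarrow> real \<Rightarrow> real" where
  "H7_poly S a z m n x y =
     (\<Sum>(p, q)\<in>Lam2 7. coef_f S a z p q m n / (fact p * fact q) * x ^ p * y ^ q)"


section \<open>The scheme\<close>

text \<open>The unknowns are \<open>c k l p\<close> with \<open>k, l \<in> {-1..1}\<close> and \<open>p \<le> 7\<close>; other values of \<open>c\<close> are
  never used.\<close>

definition linear_system ::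
  "(real \<times> real) set \<Rightarrow> (real \<times> real \<Rightarrow> real) \<Rightarrow> real \<times> real \<Rightarrow> (int \<Rightarrow> int \<Rightarrow> nat \<Rightarrow> real) \<Rightarrow> bool" where
  "linear_system S a z c \<longleftrightarrow>
     (\<forall>d\<in>{0..7}. \<forall>(m, n)\<in>Lam1 (7 - d).
        (\<Sum>k\<in>{-1..1}. \<Sum>l\<in>{-1..1}. c k l d * G_poly m n (of_int k) (of_int l)) =
        - (\<Sum>k\<in>{-1..1}. \<Sum>l\<in>{-1..1}. \<Sum>s\<in>{0..<d}. c k l s *
             (\<Sum>(p, q)\<in>{(p, q)\<in>Lam2 7 - Lam2 (m + n). p + q = m + n + d - s}.
                coef_u S a z p q m n / (fact p * fact q) * of_int k ^ p * of_int l ^ q)))"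

definition nontrivial :: "(int \<Rightarrow> int \<Rightarrow> nat \<Rightarrow> real) \<Rightarrow> bool" where
  "nontrivial c \<longleftrightarrow> (\<exists>k\<in>{-1..1}. \<exists>l\<in>{-1..1}. c k l 0 \<noteq> 0)"

definition stencil_coef :: "(int \<Rightarrow> int \<Rightarrow> nat \<Rightarrow> real) \<Rightarrow> real \<Rightarrow> int \<Rightarrow> int \<Rightarrow> real" where
  "stencil_coef c h k l = (\<Sum>p\<in>{0..7}. c k l p * h ^ p)"

definition scheme_lhs :: "(int \<Rightarrow> int \<Rightarrow> nat \<Rightarrow> real) \<Rightarrow> real \<Rightarrow> (int \<Rightarrow> int \<Rightarrow> real) \<Rightarrow> real" where
  "scheme_lhs c h v = 1 / h\<^sup>2 * (\<Sum>k\<in>{-1..1}. \<Sum>l\<in>{-1..1}. stencil_coef c h k l * v k l)"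

definition scheme_rhs ::
  "(real \<times> real) set \<Rightarrow> (real \<times> real \<Rightarrow> real) \<Rightarrow> (real \<times> real \<Rightarrow> real) \<Rightarrow> real \<times> real \<Rightarrow>
   (int \<Rightarrow> int \<Rightarrow> nat \<Rightarrow> real) \<Rightarrow> real \<Rightarrow> real" where
  "scheme_rhs S a f z c h =
     1 / h\<^sup>2 * (\<Sum>(m, n)\<in>Lam 5. jet S z f m n *
       (\<Sum>k\<in>{-1..1}. \<Sum>l\<in>{-1..1}. stencil_coef c h k l *
          H7_poly S a z m n (of_int k * h) (of_int l * h)))"

text \<open>\<open>U\<close> is ``the exact solution of the side \<open>s\<close>'': on the closed side it is \<open>u\<close>, with one-sided
  values on the curve. If the base point lies on the curve, the stencils of small mesh size
  also reach beyond it, where \<open>U\<close> is a continuation of the solution of this side; if the base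
  point is off the curve, \<open>U\<close> and \<open>u\<close> agree at all stencil points for small \<open>h\<close>.\<close>

definition side_solution ::
  "(real \<times> real) set \<Rightarrow> (real \<times> real \<Rightarrow> real) \<Rightarrow> side \<Rightarrow> (real \<times> real \<Rightarrow> real) \<Rightarrow>
   (real \<times> real \<Rightarrow> real) \<Rightarrow> bool" where
  "side_solution \<Omega> \<psi> s u U \<longleftrightarrow>
     (\<forall>p\<in>\<Omega>. on_side \<psi> s p \<longrightarrow> U p = one_sided (subdomain \<Omega> \<psi> s) u p)"

definition taylor_at_stencil ::
  "(real \<times> real) set \<Rightarrow> (real \<times> real \<Rightarrow> real) \<Rightarrow> (real \<times> real \<Rightarrow> real) \<Rightarrow> real \<times> real \<Rightarrow> bool" where
  "taylor_at_stencil S u U z \<longleftrightarrow>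
     (\<forall>k\<in>{-1..1}. \<forall>l\<in>{-1..1}.
        (\<lambda>h. U (stencil_pt z h k l) -
             (\<Sum>(m, n)\<in>Lam 7. jet S z u m n * ((of_int k * h) ^ m * (of_int l * h) ^ n / (fact m * fact n))))
        \<in> O[at_right 0](\<lambda>h. h ^ 8))"

text \<open>The base point and \<open>c\<close> stay fixed as the mesh size \<open>h\<close> tends to zero.\<close>

definition sixth_order_consistent ::
  "(real \<times> real) set \<Rightarrow> (real \<times> real \<Rightarrow> real) \<Rightarrow> (real \<times> real \<Rightarrow> real) \<Rightarrow>
   (real \<times> real \<Rightarrow> real) \<Rightarrow> real \<times> real \<Rightarrow> (int \<Rightarrow> int \<Rightarrow> nat \<Rightarrow> real) \<Rightarrow> bool" where
  "sixth_order_consistent S a f U z c \<longleftrightarrow>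
     (\<lambda>h. scheme_lhs c h (\<lambda>k l. U (stencil_pt z h k l)) - scheme_rhs S a f z c h)
     \<in> O[at_right 0](\<lambda>h. h ^ 6)"

end

theory Submission
  imports
    Defs
    "HOL-Computational_Algebra.Formal_Power_Series"
    "HOL-Computational_Algebra.Polynomial"
begin

text \<open>In terms of the formal Taylor series at the base point, the linear system says that the
  functional \<open>\<Sum> C\<^sub>k\<^sub>l(h) v(kh, lh)\<close> is \<open>O(h\<^sup>8)\<close> for every formal solution \<open>v\<close> of the homogeneous
  equation \<open>\<Delta>v + (a\<^sub>x/a) v\<^sub>x + (a\<^sub>y/a) v\<^sub>y = 0\<close>; consistency follows because the jet of \<open>u\<close> is a
  combination of such solutions and of the series of the coefficients \<open>a\<^sup>f\<close>. Since \<open>1\<close> is a solution,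
  the coefficients \<open>C\<^sub>k\<^sub>l\<close> sum to zero. For solvability, \<open>w = v \<surd>a\<close> satisfies \<open>\<Delta>w = q w\<close> with
  \<open>q = \<Delta>\<surd>a / \<surd>a\<close>, and for this equation a stencil \<open>B\<close> with leading part the nine-point Laplacian
  is written down explicitly; then \<open>C\<^sub>k\<^sub>l(h) = - B\<^sub>k\<^sub>l(h) \<surd>a(kh, lh)\<close>. Multiplying it by
  \<open>1 / (1 - t h)\<close> with \<open>t\<close> large gives every coefficient the sign of the leading one.\<close>

section \<open>Formal series in two variables\<close>

text \<open>Counting does not give solvability: level \<open>d\<close> of the system has
  \<open>15 - 2 * d\<close> equations for nine new unknowns, so the levels 0, 1 and 2 are
  overdetermined. What helps is that the truncation error of the nine-point Laplacian factors
  through \<Delta> up to order seven. For an equation without first-order terms this error can be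
  rewritten in terms of \<open>q w\<close>, which a compact stencil reproduces; the square root of
  \<open>a\<close> is chosen because it removes the first-order terms (Liouville's transformation).
  The signs are accessible because a functional that is small on all formal solutions remains so
  when its coefficients are multiplied by a common power series in the mesh size. A further obstacle
  is regularity: \<open>a\<close> has six derivatives, but seventh-order coefficients of its square
  root occur in the construction. They enter only through identities between formal series, which
  hold for any values of them.\<close>

text \<open>In \<open>real fps fps\<close> the outer variable is \<open>x\<close> and the inner one is \<open>y\<close>.\<close>

abbreviation cf :: "real fps fps \<Rightarrow> nat \<Rightarrow> nat \<Rightarrow> real" where
  "cf P p q \<equiv> fps_nth (fps_nth P p) q"

definition dx :: "real fps fps \<Rightarrow> real fps fps" where
  "dx P = fps_deriv P"

definition dy :: "real fps fps \<Rightarrow> real fps fps" where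
  "dy P = Abs_fps (\<lambda>p. fps_deriv (fps_nth P p))"

definition egf :: "(nat \<Rightarrow> nat \<Rightarrow> real) \<Rightarrow> real fps fps" where
  "egf w = Abs_fps (\<lambda>p. Abs_fps (\<lambda>q. w p q / (fact p * fact q)))"

text \<open>Membership in the \<open>N\<close>-th power of the maximal ideal \<open>(x, y)\<close>:
  stable under multiplication by any series, while each derivative costs one order.\<close>

definition vanish :: "nat \<Rightarrow> real fps fps \<Rightarrow> bool" where
  "vanish N P \<longleftrightarrow> (\<forall>p q. p + q < N \<longrightarrow> cf P p q = 0)"

text \<open>The substitution \<open>x := x X\<close>, \<open>y := y X\<close>; here \<open>X\<close> stands for the mesh size.\<close>

definition ev :: "real \<Rightarrow> real \<Rightarrow> real fps fps \<Rightarrow> real fps" where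
  "ev x y P = Abs_fps (\<lambda>n. \<Sum>p=0..n. cf P p (n - p) * x ^ p * y ^ (n - p))"

lemma cf_eqI: "(\<And>p q. cf P p q = cf Q p q) \<Longrightarrow> P = Q"
  by (simp add: fps_eq_iff)

lemma cf_egf [simp]: "cf (egf w) p q = w p q / (fact p * fact q)"
  by (simp add: egf_def)

lemma cf_dx [simp]: "cf (dx P) p q = (real p + 1) * cf P (Suc p) q"
proof -
  have "fps_nth ((1 + of_nat p) * fps_nth P (Suc p)) q = (1 + real p) * cf P (Suc p) q"
    unfolding fps_of_nat[symmetric] distrib_right by (simp add: algebra_simps)
  thus ?thesis by (simp add: dx_def add.commute)
qed

lemma dx_add: "dx (P + Q) = dx P + dx Q"
  by (simp add: dx_def)

lemma dx_diff: "dx (P - Q) = dx P - dx Q"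
  by (simp add: dx_def)

lemma dx_mult: "dx (P * Q) = P * dx Q + dx P * Q"
  by (simp add: dx_def)

lemma cf_dy [simp]: "cf (dy P) p q = (real q + 1) * cf P p (Suc q)"
  by (simp add: dy_def)

lemma cf_mult:
  "cf (P * Q) p q = (\<Sum>i=0..p. \<Sum>j=0..q. cf P i j * cf Q (p - i) (q - j))"
  by (simp add: fps_mult_nth fps_sum_nth)

lemma dy_add: "dy (P + Q) = dy P + dy Q"
  by (rule cf_eqI) (simp add: algebra_simps)

lemma dy_diff: "dy (P - Q) = dy P - dy Q"
  by (rule cf_eqI) (simp add: algebra_simps)

lemma dy_mult: "dy (P * Q) = P * dy Q + dy P * Q"
proof (rule fps_ext)
  fix p
  have "fps_nth (dy (P * Q)) p = (\<Sum>i=0..p. fps_deriv (fps_nth P i * fps_nth Q (p - i)))"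
    by (simp add: dy_def fps_mult_nth fps_deriv_sum)
  also have "\<dots> = fps_nth (P * dy Q + dy P * Q) p"
    by (simp add: dy_def fps_mult_nth sum.distrib)
  finally show "fps_nth (dy (P * Q)) p = fps_nth (P * dy Q + dy P * Q) p" .
qed

text \<open>Leibniz' rule: with exponential weights the product of series becomes the binomial
  double sum of \<open>elim_rec\<close>, with \<open>w\<close> at the indices \<open>i\<close>,
  \<open>j\<close> and \<open>r\<close> at the complementary ones.\<close>

lemma cf_egf_mult:
  "cf (egf r * egf w) p q * (fact p * fact q) =
     (\<Sum>i=0..p. \<Sum>j=0..q. of_nat (p choose i) * of_nat (q choose j) * (r (p - i) (q - j) * w i j))"
proof -
  have *: "w i j / (fact i * fact j) * (r (p - i) (q - j) / (fact (p - i) * fact (q - j))) *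
      (fact p * fact q) = of_nat (p choose i) * of_nat (q choose j) * (r (p - i) (q - j) * w i j)"
    if "i \<le> p" "j \<le> q" for i j
    using that by (simp add: binomial_fact mult_ac)
  show ?thesis
    unfolding mult.commute[of "egf r"] cf_mult sum_distrib_right by (intro sum.cong refl) (simp only: cf_egf *  atLeastAtMost_iff)
qed

lemma vanish_mono: "vanish M P \<Longrightarrow> N \<le> M \<Longrightarrow> vanish N P"
  by (auto simp: vanish_def)

lemma vanish_0 [simp]: "vanish N 0"
  by (simp add: vanish_def)

lemma vanish_add: "vanish N P \<Longrightarrow> vanish N Q \<Longrightarrow> vanish N (P + Q)"
  by (simp add: vanish_def)

lemma vanish_minus: "vanish N P \<Longrightarrow> vanish N (- P)"
  by (simp add: vanish_def)

lemma vanish_diff: "vanish N P \<Longrightarrow> vanish N Q \<Longrightarrow> vanish N (P - Q)"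
  by (simp add: vanish_def)

lemma vanish_mult_left: "vanish N P \<Longrightarrow> vanish N (P * Q)"
  unfolding vanish_def cf_mult by (auto intro!: sum.neutral)

lemma vanish_mult_right: "vanish N P \<Longrightarrow> vanish N (Q * P)"
  using vanish_mult_left[of N P Q] by (simp add: mult.commute)

lemma vanish_dx: "vanish (Suc N) P \<Longrightarrow> vanish N (dx P)"
  by (simp add: vanish_def)

text \<open>In characteristic zero a series is determined by its constant term and its two first
  derivatives. This is the induction step by which identities between functions pass to their Taylor
  series.\<close>

lemma vanish_SucI:
  assumes "cf P 0 0 = 0" "vanish N (dx P)" "vanish N (dy P)"
  shows "vanish (Suc N) P"
  unfolding vanish_def
proof (intro allI impI)
  fix p q assume *: "p + q < Suc N"
  show "cf P p q = 0"
  proof (cases p)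
    case 0
    show ?thesis
    proof (cases q)
      case (Suc q')
      have "cf (dy P) 0 q' = 0" using assms(3) * 0 Suc unfolding vanish_def by simp
      thus ?thesis using 0 Suc by simp
    qed (use 0 assms in simp)
  next
    case (Suc p')
    have "cf (dx P) p' q = 0" using assms(2) * Suc unfolding vanish_def by simp
    hence "(real p' + 1) * cf P p q = 0" using Suc by simp
    moreover have "real p' + 1 \<noteq> 0" by linarith
    ultimately show ?thesis by simp
  qed
qed

lemma ev_nth: "fps_nth (ev x y P) n = (\<Sum>p=0..n. cf P p (n - p) * x ^ p * y ^ (n - p))"
  by (simp add: ev_def)

lemma ev_vanish: "vanish N P \<Longrightarrow> n < N \<Longrightarrow> fps_nth (ev x y P) n = 0"
  unfolding ev_nth vanish_def by (intro sum.neutral) auto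

text \<open>Since substitution is a ring homomorphism, a stencil acting on \<open>P * Q\<close> is
  the stencil with node weights multiplied by the values of \<open>P\<close>, acting on
  \<open>Q\<close>. Both the potential and the factor \<beta> are built into stencils in this
  way.\<close>

lemma ev_mult: "ev x y (P * Q) = ev x y P * ev x y Q"
proof (rule fps_ext)
  fix n
  define t where "t = (\<lambda>i j i' j'. cf P i j * cf Q i' j' * x ^ (i + i') * y ^ (j + j'))"
  have "fps_nth (ev x y (P * Q)) n = (\<Sum>p=0..n. \<Sum>i=0..p. \<Sum>j=0..n-p. t i j (p - i) (n - p - j))"
    unfolding ev_nth cf_mult sum_distrib_right
    by (auto intro!: sum.cong simp: t_def)
  also have "\<dots> = (\<Sum>(p, i, j)\<in>(SIGMA p:{0..n}. SIGMA i:{0..p}. {0..n-p}). t i j (p - i) (n - p - j))"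
    by (simp add: sum.Sigma)
  \<comment> \<open>The monomials are regrouped: by the total degree \<open>m\<close> of the factor
    from \<open>P\<close> instead of the total power \<open>p\<close> of \<open>x\<close>.\<close>
  also have "\<dots> = (\<Sum>(m, i, i')\<in>(SIGMA m:{0..n}. SIGMA i:{0..m}. {0..n-m}). t i (m - i) i' (n - m - i'))"
    by (rule sum.reindex_bij_witness[where i = "\<lambda>(m, i, i'). (i + i', i, m - i)"
          and j = "\<lambda>(p, i, j). (i + j, i, p - i)"]) (auto simp: algebra_simps)
  also have "\<dots> = (\<Sum>m=0..n. \<Sum>i=0..m. \<Sum>i'=0..n-m. t i (m - i) i' (n - m - i'))"
    by (simp add: sum.Sigma)
  also have "\<dots> = fps_nth (ev x y P * ev x y Q) n"
    unfolding fps_mult_nth ev_nth sum_product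
    by (auto intro!: sum.cong simp: t_def power_add)
  finally show "fps_nth (ev x y (P * Q)) n = fps_nth (ev x y P * ev x y Q) n" .
qed

lemma sum_unit_range: "(\<Sum>k\<in>{-1..1::int}. g k) = g (-1) + g 0 + (g 1 :: 'a::comm_monoid_add)"
proof -
  have "{-1..1::int} = {-1, 0, 1}" by auto
  thus ?thesis by (simp add: add.assoc)
qed

section \<open>A sixth-order stencil for an equation with a potential\<close>

definition lap :: "real fps fps \<Rightarrow> real fps fps" where
  "lap P = dx (dx P) + dy (dy P)"

lemma cf_lap: "cf (lap P) p q =
    (real p + 1) * (real p + 2) * cf P (Suc (Suc p)) q + (real q + 1) * (real q + 2) * cf P p (Suc (Suc q))"
  by (simp add: lap_def algebra_simps)

text \<open>The compact nine-point Laplacian, scaled by six times the squared mesh size. All its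
  entries off the centre are strictly positive, which later decides the signs.\<close>

definition lap9 :: "int \<Rightarrow> int \<Rightarrow> real" where
  "lap9 k l = (if k = 0 \<and> l = 0 then -20 else if k = 0 \<or> l = 0 then 4 else 1)"

text \<open>In difference notation this is \<open>6 + (\<delta>\<^sub>x\<^sup>2 + \<delta>\<^sub>y\<^sup>2) / 2 + 7/60 \<delta>\<^sub>x\<^sup>2 \<delta>\<^sub>y\<^sup>2\<close>; the weight \<open>7/60\<close> makes
  the sixth-order term left over by \<open>lap9\<close> a multiple of the bilaplacian.\<close>

definition src9 :: "int \<Rightarrow> int \<Rightarrow> real" where
  "src9 k l = (if k = 0 \<and> l = 0 then 67/15 else if k = 0 \<or> l = 0 then 4/15 else 7/60)"

definition first9 :: "real \<Rightarrow> real \<Rightarrow> int \<Rightarrow> int \<Rightarrow> real" where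
  "first9 b10 b01 k l = (if l = 0 then b10 * of_int k / 2 else 0) + (if k = 0 then b01 * of_int l / 2 else 0)"

text \<open>Differences normalised to Taylor coefficients: the halved second difference returns
  \<open>cf W 2 0\<close>, and the four corners with alternating weights 1/4 return
  \<open>cf W 1 1\<close>.\<close>

definition second9 :: "real \<Rightarrow> real \<Rightarrow> real \<Rightarrow> int \<Rightarrow> int \<Rightarrow> real" where
  "second9 b20 b11 b02 k l =
     (if l = 0 then b20 * (if k = 0 then -1 else 1/2) else 0) +
     (if k = 0 then b02 * (if l = 0 then -1 else 1/2) else 0) + b11 * of_int (k * l) / 4"


lemmas stencil_simps = sum_unit_range fps_sum_nth ev_nth eval_nat_numeral

text \<open>Odd orders cancel by symmetry. In derivatives at the base point, the orders 2, 4, 6 are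
  \<open>6 f\<close>, \<open>Lap f / 2\<close> and \<open>(Lap^2 f + 2 f_xxyy) / 60\<close>, where
  \<open>f\<close> is the Laplacian of \<open>W\<close>. The factorization through the Laplacian
  holds for every \<open>W\<close>.\<close>

lemma lap9_ev:
  fixes W :: "real fps fps"
  defines "f \<equiv> cf (lap W)"
  defines "L \<equiv> \<Sum>k\<in>{-1..1}. \<Sum>l\<in>{-1..1}. fps_const (lap9 k l) * ev (of_int k) (of_int l) W"
  assumes "n < 8"
  shows "fps_nth L n =
     (if n = 2 then 6 * f 0 0 else if n = 4 then f 2 0 + f 0 2
      else if n = 6 then 2/5 * (f 4 0 + f 0 4) + 4/15 * f 2 2 else 0)"
proof -
  consider "n = 0" | "n = 1" | "n = 2" | "n = 3" | "n = 4" | "n = 5" | "n = 6" | "n = 7"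
    using assms(3) by linarith
  thus ?thesis
    by cases (simp_all add: L_def f_def stencil_simps lap9_def cf_lap field_simps)
qed

lemma src9_ev:
  fixes F :: "real fps fps"
  defines "f \<equiv> cf F"
  defines "L \<equiv> \<Sum>k\<in>{-1..1}. \<Sum>l\<in>{-1..1}. fps_const (src9 k l) * ev (of_int k) (of_int l) F"
  assumes "n < 6"
  shows "fps_nth L n =
     (if n = 0 then 6 * f 0 0 else if n = 2 then f 2 0 + f 0 2
      else if n = 4 then f 4 0 + f 0 4 + 7/15 * f 2 2 else 0)"
proof -
  consider "n = 0" | "n = 1" | "n = 2" | "n = 3" | "n = 4" | "n = 5"
    using assms(3) by linarith
  thus ?thesis
    by cases (simp_all add: L_def f_def stencil_simps src9_def field_simps)
qed

text \<open>The error starts at order 3, and for \<open>second9\<close> at order 4; multiplied by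
  \<open>fps_X ^ 5\<close> and \<open>fps_X ^ 4\<close>, both land at order 8.\<close>

lemma first9_ev:
  fixes W :: "real fps fps" and b10 b01 :: real
  defines "L \<equiv> \<Sum>k\<in>{-1..1}. \<Sum>l\<in>{-1..1}. fps_const (first9 b10 b01 k l) * ev (of_int k) (of_int l) W"
  assumes "n < 3"
  shows "fps_nth L n = (if n = 1 then b10 * cf W 1 0 + b01 * cf W 0 1 else 0)"
proof -
  consider "n = 0" | "n = 1" | "n = 2"
    using assms(2) by linarith
  thus ?thesis
    by cases (simp_all add: L_def stencil_simps first9_def field_simps)
qed

lemma second9_ev:
  fixes W :: "real fps fps" and b20 b11 b02 :: real
  defines "L \<equiv> \<Sum>k\<in>{-1..1}. \<Sum>l\<in>{-1..1}. fps_const (second9 b20 b11 b02 k l) * ev (of_int k) (of_int l) W"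
  assumes "n < 4"
  shows "fps_nth L n = (if n = 2 then b20 * cf W 2 0 + b11 * cf W 1 1 + b02 * cf W 0 2 else 0)"
proof -
  consider "n = 0" | "n = 1" | "n = 2" | "n = 3"
    using assms(2) by linarith
  thus ?thesis
    by cases (simp_all add: L_def stencil_simps second9_def field_simps)
qed

text \<open>The left side is the bilaplacian of \<open>Q W\<close>. In its product expansion,
  derivatives of \<open>W\<close> of order three and four occur only as the gradient of
  \<open>Lap W\<close> and as \<open>Lap^2 W\<close>; by \<open>Lap W = Q W\<close> they become
  derivatives of \<open>Q W\<close> of order one and two.\<close>

lemma bilaplacian_potential:
  fixes Q W :: "real fps fps"
  defines "q \<equiv> cf Q" and "t \<equiv> cf W" and "f \<equiv> cf (Q * W)"
  assumes "vanish 6 (lap W - Q * W)"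
  shows "24 * f 4 0 + 8 * f 2 2 + 24 * f 0 4 =
    (2 * q 0 0 * q 2 0 + 2 * q 0 0 * q 0 2 + 4 * (q 1 0)\<^sup>2 + 4 * (q 0 1)\<^sup>2 +
      24 * q 4 0 + 8 * q 2 2 + 24 * q 0 4) * t 0 0 +
    ((6 * q 0 0 * q 1 0 + 24 * q 3 0 + 8 * q 1 2) * t 1 0 +
     (6 * q 0 0 * q 0 1 + 24 * q 0 3 + 8 * q 2 1) * t 0 1) +
    ((2 * (q 0 0)\<^sup>2 + 24 * q 2 0 + 8 * q 0 2) * t 2 0 + 8 * q 1 1 * t 1 1 +
     (2 * (q 0 0)\<^sup>2 + 8 * q 2 0 + 24 * q 0 2) * t 0 2)"
proof -
  have rel: "cf (lap W) i j = f i j" if "i + j < 6" for i j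
    using assms that by (simp add: vanish_def)
  have f: "f i j = (\<Sum>k=0..i. \<Sum>l=0..j. q k l * t (i - k) (j - l))" for i j
    by (simp add: f_def q_def t_def cf_mult)
  have four: "24 * t 4 0 + 8 * t 2 2 + 24 * t 0 4 = 2 * f 2 0 + 2 * f 0 2"
    using rel[of 2 0] rel[of 0 2] by (simp add: cf_lap t_def eval_nat_numeral)
  have three: "24 * t 3 0 + 8 * t 1 2 = 4 * f 1 0" "24 * t 0 3 + 8 * t 2 1 = 4 * f 0 1"
    using rel[of 1 0] rel[of 0 1] by (simp_all add: cf_lap t_def eval_nat_numeral)
  have "24 * f 4 0 + 8 * f 2 2 + 24 * f 0 4 =
      q 0 0 * (24 * t 4 0 + 8 * t 2 2 + 24 * t 0 4) +
      q 1 0 * (24 * t 3 0 + 8 * t 1 2) + q 0 1 * (24 * t 0 3 + 8 * t 2 1) +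
      q 2 0 * (24 * t 2 0 + 8 * t 0 2) + 8 * q 1 1 * t 1 1 + q 0 2 * (8 * t 2 0 + 24 * t 0 2) +
      (24 * q 3 0 + 8 * q 1 2) * t 1 0 + (24 * q 0 3 + 8 * q 2 1) * t 0 1 +
      (24 * q 4 0 + 8 * q 2 2 + 24 * q 0 4) * t 0 0"
    by (simp add: f eval_nat_numeral algebra_simps)
  moreover have "f 2 0 = q 0 0 * t 2 0 + q 1 0 * t 1 0 + q 2 0 * t 0 0"
    "f 0 2 = q 0 0 * t 0 2 + q 0 1 * t 0 1 + q 0 2 * t 0 0"
    "f 1 0 = q 0 0 * t 1 0 + q 1 0 * t 0 0" "f 0 1 = q 0 0 * t 0 1 + q 0 1 * t 0 0"
    by (simp_all add: f eval_nat_numeral)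
  ultimately show ?thesis
    unfolding four three by (simp add: algebra_simps power2_eq_square)
qed

text \<open>If \<open>\<Delta>W = Q W\<close>, then \<open>lap9\<close> applied to \<open>W\<close> minus \<open>X\<^sup>2\<close> times \<open>src9\<close> applied to \<open>Q W\<close> is
  \<open>- X\<^sup>6/40 \<Delta>\<^sup>2(Q W)(0)\<close> up to \<open>O(X\<^sup>8)\<close>. This value only involves derivatives of \<open>W\<close> of order at
  most two, which central differences reproduce accurately enough.\<close>

lemma schroedinger_stencil_exists:
  fixes Q :: "real fps fps"
  obtains B :: "int \<Rightarrow> int \<Rightarrow> real fps" where
    "\<And>k l. fps_nth (B k l) 0 = lap9 k l"
    "\<And>W n. vanish 6 (lap W - Q * W) \<Longrightarrow> n < 8 \<Longrightarrow>
       fps_nth (\<Sum>k\<in>{-1..1}. \<Sum>l\<in>{-1..1}. B k l * ev (of_int k) (of_int l) W) n = 0"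
proof -
  define q where "q = cf Q"
  define b00 where "b00 = (2 * q 0 0 * q 2 0 + 2 * q 0 0 * q 0 2 + 4 * (q 1 0)\<^sup>2 + 4 * (q 0 1)\<^sup>2 +
      24 * q 4 0 + 8 * q 2 2 + 24 * q 0 4) / 40"
  define b10 where "b10 = (6 * q 0 0 * q 1 0 + 24 * q 3 0 + 8 * q 1 2) / 40"
  define b01 where "b01 = (6 * q 0 0 * q 0 1 + 24 * q 0 3 + 8 * q 2 1) / 40"
  define b20 where "b20 = (2 * (q 0 0)\<^sup>2 + 24 * q 2 0 + 8 * q 0 2) / 40"
  define b11 where "b11 = 8 * q 1 1 / 40"
  define b02 where "b02 = (2 * (q 0 0)\<^sup>2 + 8 * q 2 0 + 24 * q 0 2) / 40"
  \<comment> \<open>The constants \<open>b\<close> are the coefficients from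
    \<open>bilaplacian_potential\<close> over 40. A difference of order \<open>j\<close> is itself
    of order \<open>j\<close> in the mesh size, so it carries the power \<open>6 - j\<close> of
    \<open>fps_X\<close>.\<close>
  define B where "B = (\<lambda>k l. fps_const (lap9 k l)
      - fps_X ^ 2 * (fps_const (src9 k l) * ev (of_int k) (of_int l) Q)
      + fps_X ^ 4 * fps_const (second9 b20 b11 b02 k l) + fps_X ^ 5 * fps_const (first9 b10 b01 k l)
      + fps_X ^ 6 * fps_const (if k = 0 \<and> l = 0 then b00 else 0))"
  show ?thesis
  proof (rule that)
    show "fps_nth (B k l) 0 = lap9 k l" for k l
      by (simp add: B_def)
  next
    fix W :: "real fps fps" and n :: nat
    assume W: "vanish 6 (lap W - Q * W)" and n: "n < 8"
    have rel: "cf (lap W) i j = cf (Q * W) i j" if "i + j < 6" for i j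
      using W that by (simp add: vanish_def)
    define E where "E = (\<lambda>k l. ev (of_int k) (of_int l) W)"
    have "(\<Sum>k\<in>{-1..1}. \<Sum>l\<in>{-1..1}. B k l * E k l) =
        (\<Sum>k\<in>{-1..1}. \<Sum>l\<in>{-1..1}. fps_const (lap9 k l) * E k l)
      - fps_X ^ 2 * (\<Sum>k\<in>{-1..1}. \<Sum>l\<in>{-1..1}. fps_const (src9 k l) * ev (of_int k) (of_int l) (Q * W))
      + fps_X ^ 4 * (\<Sum>k\<in>{-1..1}. \<Sum>l\<in>{-1..1}. fps_const (second9 b20 b11 b02 k l) * E k l)
      + fps_X ^ 5 * (\<Sum>k\<in>{-1..1}. \<Sum>l\<in>{-1..1}. fps_const (first9 b10 b01 k l) * E k l)
      + fps_X ^ 6 * (\<Sum>k\<in>{-1..1}. \<Sum>l\<in>{-1..1}. fps_const (if k = 0 \<and> l = 0 then b00 else 0) * E k l)"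
      unfolding B_def ev_mult E_def[symmetric]
      by (simp add: algebra_simps sum.distrib sum_subtractf sum_distrib_left E_def)
    moreover have "(\<Sum>k\<in>{-1..1}. \<Sum>l\<in>{-1..1}. fps_const (if k = 0 \<and> l = 0 then b00 else 0) * E k l)
        = fps_const b00 * E 0 0"
      by (simp add: sum_unit_range)
    moreover have "fps_nth (E 0 0) m = (if m = 0 then cf W 0 0 else 0)" for m
    proof -
      have "cf W p (m - p) * 0 ^ p * 0 ^ (m - p) = (if p = 0 then if m = 0 then cf W 0 0 else 0 else 0)"
        for p by auto
      thus ?thesis by (simp add: E_def ev_nth)
    qed
    ultimately have "fps_nth (\<Sum>k\<in>{-1..1}. \<Sum>l\<in>{-1..1}. B k l * E k l) n =
        (if n = 6 then 2/5 * (cf (Q * W) 4 0 + cf (Q * W) 0 4) + 4/15 * cf (Q * W) 2 2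
           - (cf (Q * W) 4 0 + cf (Q * W) 0 4 + 7/15 * cf (Q * W) 2 2) + b00 * cf W 0 0
           + (b10 * cf W 1 0 + b01 * cf W 0 1)
           + (b20 * cf W 2 0 + b11 * cf W 1 1 + b02 * cf W 0 2) else 0)"
      using n unfolding E_def
      by (auto simp: fps_X_power_mult_nth lap9_ev src9_ev first9_ev second9_ev rel)
    also have "\<dots> = 0"
      using bilaplacian_potential[OF W]
      by (simp add: b00_def b10_def b01_def b20_def b11_def b02_def q_def field_simps)
    finally show "fps_nth (\<Sum>k\<in>{-1..1}. \<Sum>l\<in>{-1..1}. B k l * ev (of_int k) (of_int l) W) n = 0"
      by (simp add: E_def)
  qed
qed

section \<open>The linear system as a condition on formal solutions\<close>

lemma dx_egf: "dx (egf w) = egf (\<lambda>p. w (Suc p))"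
proof (rule cf_eqI)
  fix p q
  have "real p + 1 \<noteq> 0" by linarith
  thus "cf (dx (egf w)) p q = cf (egf (\<lambda>p. w (Suc p))) p q" by (simp add: divide_simps)
qed

lemma dy_egf: "dy (egf w) = egf (\<lambda>p q. w p (Suc q))"
proof (rule cf_eqI)
  fix p q
  have "real q + 1 \<noteq> 0" by linarith
  thus "cf (dy (egf w)) p q = cf (egf (\<lambda>p q. w p (Suc q))) p q" by (simp add: divide_simps)
qed

lemma egf_add: "egf (\<lambda>p q. v p q + w p q) = egf v + egf w"
  by (rule cf_eqI) (simp add: add_divide_distrib)

lemma lap_egf: "lap (egf w) = egf (\<lambda>p q. w (p + 2) q + w p (q + 2))"
  by (simp add: lap_def dx_egf dy_egf egf_add)

section \<open>The equation divided by \<open>a\<close> and its formal solutions\<close>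

definition elim_op :: "real fps fps \<Rightarrow> real fps fps \<Rightarrow> real fps fps \<Rightarrow> real fps fps" where
  "elim_op R1 R2 P = lap P + R1 * dx P + R2 * dy P"

text \<open>The recursion is the equation, differentiated \<open>p\<close> times in \<open>x\<close>
  and \<open>q\<close> times in \<open>y\<close>, solved for the entry \<open>(p + 2, q)\<close>;
  \<open>ini\<close> supplies Cauchy data on \<open>x = 0\<close>. The shift in \<open>eps\<close>
  arises because it is indexed by the entry solved for.\<close>

lemma elim_op_elim_rec:
  "elim_op (egf rx) (egf ry) (egf (elim_rec rx ry ini eps)) + egf (\<lambda>p. eps (p + 2)) = 0"
proof (rule cf_eqI)
  fix p q
  define w where "w = elim_rec rx ry ini eps"
  define G where "G = elim_op (egf rx) (egf ry) (egf w) + egf (\<lambda>p. eps (p + 2))"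
  have "cf G p q * (fact p * fact q) =
      (w (p + 2) q + w p (q + 2)) + eps (p + 2) q
      + cf (egf rx * egf (\<lambda>p. w (Suc p))) p q * (fact p * fact q)
      + cf (egf ry * egf (\<lambda>p q. w p (Suc q))) p q * (fact p * fact q)"
    by (simp add: G_def elim_op_def lap_egf dx_egf dy_egf field_simps)
  also have "\<dots> = 0"
    unfolding cf_egf_mult
    by (simp add: w_def numeral_2_eq_2 distrib_left sum.distrib)
  finally show "cf (elim_op (egf rx) (egf ry) (egf (elim_rec rx ry ini eps)) + egf (\<lambda>p. eps (p + 2))) p q
      = cf 0 p q"
    by (simp add: G_def w_def)
qed

text \<open>Uniqueness for the Cauchy problem with data on \<open>x = 0\<close>: the equation at
  \<open>(p - 2, q)\<close> expresses the coefficient \<open>(p, q)\<close> by coefficients with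
  smaller \<open>p\<close> and total order at most \<open>p + q\<close>. The bounds 6 and 8 differ
  by the order of the equation.\<close>

lemma elim_op_unique:
  assumes "vanish 6 (elim_op R1 R2 P)" "\<And>p q. p \<le> 1 \<Longrightarrow> p + q < 8 \<Longrightarrow> cf P p q = 0"
  shows "vanish 8 P"
proof -
  have "cf P p q = 0" if "p + q < 8" for p q
    using that
  proof (induction p arbitrary: q rule: less_induct)
    case (less p)
    show ?case
    proof (cases "p \<le> 1")
      case False
      then obtain r where p: "p = Suc (Suc r)" by (metis One_nat_def not_less_eq_eq old.nat.exhaust zero_le)
      have "cf (R1 * dx P) r q = 0"
        unfolding cf_mult using less p by (auto intro!: sum.neutral)
      moreover have "cf (R2 * dy P) r q = 0"
        unfolding cf_mult using less p by (auto intro!: sum.neutral)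
      moreover have "cf P r (Suc (Suc q)) = 0"
        using less p by simp
      moreover have "cf (elim_op R1 R2 P) r q = 0"
        using assms(1) less.prems p by (simp add: vanish_def)
      ultimately have "(real r + 1) * (real r + 2) * cf P p q = 0"
        by (simp add: elim_op_def cf_lap p)
      moreover have "(real r + 1) * (real r + 2) \<noteq> 0" 
        by (simp add: add_nonneg_eq_0_iff)
      ultimately show ?thesis by simp
    qed (use assms less in auto)
  qed
  thus ?thesis by (simp add: vanish_def)
qed

lemma coef_u_initial: "p \<le> 1 \<Longrightarrow> coef_u S a z p q m n = (if (m, n) = (p, q) then 1 else 0)"
  by (cases p) (auto simp: coef_u_def le_Suc_eq)

lemma coef_f_initial: "p \<le> 1 \<Longrightarrow> coef_f S a z p q m n = 0"
  by (cases p) (auto simp: coef_f_def le_Suc_eq)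

lemma coef_u_step:
  "coef_u S a z (Suc (Suc p)) q m n =
     - coef_u S a z p (q + 2) m n -
     (\<Sum>i\<in>{0..p}. \<Sum>j\<in>{0..q}. of_nat (p choose i) * of_nat (q choose j) *
        (jet S z (\<lambda>w. partial_x a w / a w) (p - i) (q - j) * coef_u S a z (i + 1) j m n +
         jet S z (\<lambda>w. partial_y a w / a w) (p - i) (q - j) * coef_u S a z i (j + 1) m n))"
  by (simp add: coef_u_def)

lemma coef_u_below: "p + q < m + n \<Longrightarrow> coef_u S a z p q m n = 0"
proof (induction p arbitrary: q rule: less_induct)
  case (less p)
  show ?case
  proof (cases "p \<le> 1")
    case False
    then obtain r where p: "p = Suc (Suc r)" by (metis One_nat_def not_less_eq_eq old.nat.exhaust zero_le)
    show ?thesis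
      using less unfolding p coef_u_step by (auto intro!: sum.neutral)
  qed (use less in \<open>auto simp: coef_u_initial\<close>)
qed

text \<open>The terms with \<open>a_x / a\<close> and \<open>a_y / a\<close> have lower total order
  and drop out by \<open>coef_u_below\<close>. What remains is the recursion of Laplace's equation,
  whose solutions are the harmonic polynomials \<open>G_poly\<close>.\<close>

lemma coef_u_diagonal:
  assumes "m \<le> 1" "p + q = m + n"
  shows "coef_u S a z p q m n = (if m \<le> p \<and> even (p - m) then (-1) ^ ((p - m) div 2) else 0)"
  using assms(2)
proof (induction p arbitrary: q rule: less_induct)
  case (less p)
  show ?case
  proof (cases "p \<le> 1")
    case True
    thus ?thesis using less.prems assms(1) by (auto simp: coef_u_initial le_Suc_eq)
  next
    case False
    then obtain r where p: "p = Suc (Suc r)" by (metis One_nat_def not_less_eq_eq old.nat.exhaust zero_le)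
    have "coef_u S a z p q m n = - coef_u S a z r (q + 2) m n"
      using less.prems unfolding p coef_u_step by (auto intro!: sum.neutral simp: coef_u_below)
    also have "\<dots> = - (if m \<le> r \<and> even (r - m) then (-1) ^ ((r - m) div 2) else 0)"
      using less.IH[of r "q + 2"] less.prems p by simp
    also have "\<dots> = (if m \<le> p \<and> even (p - m) then (-1) ^ ((p - m) div 2) else 0)"
    proof (cases "m \<le> r")
      case True
      hence "p - m = Suc (Suc (r - m))" using p by simp
      thus ?thesis using True p by simp
    next
      case False
      hence "r = 0" "m = 1" using assms(1) by auto
      thus ?thesis using p by simp
    qed
    finally show ?thesis .
  qed
qed

text \<open>Constants solve the homogeneous equation, which contains only derivatives of the
  unknown.\<close>

lemma coef_u_0_0: "coef_u S a z p q 0 0 = (if p = 0 \<and> q = 0 then 1 else 0)"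
proof (induction p arbitrary: q rule: less_induct)
  case (less p)
  show ?case
  proof (cases "p \<le> 1")
    case False
    then obtain r where p: "p = Suc (Suc r)" by (metis One_nat_def not_less_eq_eq old.nat.exhaust zero_le)
    show ?thesis
      using less unfolding p coef_u_step by (auto intro!: sum.neutral)
  qed (auto simp: coef_u_initial)
qed

text \<open>For \<open>(m, n)\<close> in \<open>Lam1 7\<close>, the formal homogeneous solution with
  a single normalised monomial as Cauchy data on \<open>x = 0\<close>; these span all homogeneous
  solutions up to order 7. Its counterpart \<open>fund_f\<close> has zero data and a monomial
  source.\<close>

definition fund_u ::
  "(real \<times> real) set \<Rightarrow> (real \<times> real \<Rightarrow> real) \<Rightarrow> real \<times> real \<Rightarrow> nat \<Rightarrow> nat \<Rightarrow> real fps fps" where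
  "fund_u S a z m n = egf (\<lambda>p q. coef_u S a z p q m n)"

definition fund_f ::
  "(real \<times> real) set \<Rightarrow> (real \<times> real \<Rightarrow> real) \<Rightarrow> real \<times> real \<Rightarrow> nat \<Rightarrow> nat \<Rightarrow> real fps fps" where
  "fund_f S a z m n = egf (\<lambda>p q. coef_f S a z p q m n)"

lemma elim_op_fund_u:
  "elim_op (egf (jet S z (\<lambda>w. partial_x a w / a w))) (egf (jet S z (\<lambda>w. partial_y a w / a w)))
     (fund_u S a z m n) = 0"
proof -
  have "egf (\<lambda>p q. 0) = 0" by (rule cf_eqI) simp
  thus ?thesis
    using elim_op_elim_rec[of "jet S z (\<lambda>w. partial_x a w / a w)" "jet S z (\<lambda>w. partial_y a w / a w)"
        "\<lambda>p q. if (m, n) = (p, q) then 1 else 0" "\<lambda>p q. 0"]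
    by (simp add: fund_u_def coef_u_def)
qed

text \<open>The source is \<open>f / a\<close> with \<open>f\<close> a normalised monomial; Leibniz'
  rule for this product collapses to one summand, which is the inhomogeneity in
  \<open>coef_f\<close>.\<close>

lemma elim_op_fund_f:
  "elim_op (egf (jet S z (\<lambda>w. partial_x a w / a w))) (egf (jet S z (\<lambda>w. partial_y a w / a w)))
     (fund_f S a z m n)
   + egf (jet S z (\<lambda>w. 1 / a w)) * egf (\<lambda>p q. if (m, n) = (p, q) then 1 else 0) = 0"
proof -
  define A where "A = jet S z (\<lambda>w. 1 / a w)"
  define eps where "eps = (\<lambda>p q. if m + 2 \<le> p \<and> n \<le> q
      then real ((p - 2) choose m) * real (q choose n) * A (p - 2 - m) (q - n) else 0)"
  have "egf A * egf (\<lambda>p q. if (m, n) = (p, q) then 1 else 0) = egf (\<lambda>p. eps (p + 2))"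
  proof (rule cf_eqI)
    fix p q
    have "cf (egf A * egf (\<lambda>p q. if (m, n) = (p, q) then 1 else 0)) p q * (fact p * fact q) =
        (\<Sum>i=0..p. if m = i then \<Sum>j=0..q. if n = j then real (p choose i) * real (q choose j) * A (p - i) (q - j) else 0 else 0)"
    proof -
      have "(\<Sum>j=0..q. real (p choose i) * real (q choose j) *
            (A (p - i) (q - j) * (if (m, n) = (i, j) then 1 else 0))) =
          (\<Sum>j=0..q. if m = i then if n = j then real (p choose i) * real (q choose j) * A (p - i) (q - j) else 0 else 0)" for i
        by (intro sum.cong refl) auto
      thus ?thesis
        unfolding cf_egf_mult by (intro sum.cong refl) auto
    qed
    also have "\<dots> = eps (p + 2) q"
      by (simp add: eps_def)
    finally show "cf (egf A * egf (\<lambda>p q. if (m, n) = (p, q) then 1 else 0)) p q = cf (egf (\<lambda>p. eps (p + 2))) p q"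
      by (simp add: field_simps)
  qed
  moreover have "fund_f S a z m n = egf (elim_rec (jet S z (\<lambda>w. partial_x a w / a w))
      (jet S z (\<lambda>w. partial_y a w / a w)) (\<lambda>p q. 0) eps)"
    unfolding fund_f_def coef_f_def eps_def A_def by (rule refl)
  ultimately show ?thesis
    by (simp only: elim_op_elim_rec A_def)
qed

section \<open>Values of the homogeneous solutions at the stencil points\<close>

lemma ev_nth_pairs:
  "fps_nth (ev x y P) N = (\<Sum>(p, q)\<in>{(p, q). p + q = N}. cf P p q * x ^ p * y ^ q)"
  unfolding ev_nth
  by (rule sum.reindex_bij_witness[where i = fst and j = "\<lambda>p. (p, N - p)"]) auto

lemma ev_fund_u_below: "N < m + n \<Longrightarrow> fps_nth (ev x y (fund_u S a z m n)) N = 0"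
  by (rule ev_vanish[of "m + n"]) (auto simp: vanish_def fund_u_def coef_u_below)

lemma ev_fund_u_diagonal:
  assumes "m \<le> 1"
  shows "fps_nth (ev x y (fund_u S a z m n)) (m + n) = G_poly m n x y"
proof -
  have "fps_nth (ev x y (fund_u S a z m n)) (m + n) =
      (\<Sum>p=0..m+n. (if m \<le> p \<and> even (p - m) then (-1) ^ ((p - m) div 2) else 0) /
         (fact p * fact (m + n - p)) * x ^ p * y ^ (m + n - p))"
    unfolding ev_nth using assms
    by (intro sum.cong refl) (auto simp: fund_u_def coef_u_diagonal)
  also have "\<dots> = (\<Sum>p\<in>{p\<in>{0..m+n}. m \<le> p \<and> even (p - m)}. (-1) ^ ((p - m) div 2) /
         (fact p * fact (m + n - p)) * x ^ p * y ^ (m + n - p))"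
    by (rule sum.mono_neutral_cong_right) auto
  also have "\<dots> = G_poly m n x y"
    unfolding G_poly_def
    by (rule sum.reindex_bij_witness[where i = "\<lambda>l. m + 2 * l" and j = "\<lambda>p. (p - m) div 2"])
      (auto elim!: evenE simp: add.commute)
  finally show ?thesis .
qed

text \<open>The Cauchy data sit in total order \<open>m + n\<close>, so in a higher order
  \<open>N\<close> all entries with \<open>p <= 1\<close> are zero. The remaining ones form the
  inner index set of the linear system.\<close>

lemma ev_fund_u_above:
  assumes "m + n < N" "N \<le> 7"
  shows "fps_nth (ev x y (fund_u S a z m n)) N =
    (\<Sum>(p, q)\<in>{(p, q)\<in>Lam2 7 - Lam2 (m + n). p + q = N}.
       coef_u S a z p q m n / (fact p * fact q) * x ^ p * y ^ q)"
proof -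
  have "finite {(p, q). p + q = N}"
    by (rule finite_subset[of _ "{..N} \<times> {..N}"]) auto
  moreover have "1 < p" if "p + q = N" "coef_u S a z p q m n \<noteq> 0" for p q
    using that assms by (cases "1 < p") (auto simp: coef_u_initial split: if_splits)
  moreover have "{(p, q)\<in>Lam2 7 - Lam2 (m + n). p + q = N} = {(p, q). p + q = N \<and> 1 < p}"
    using assms by (auto simp: Lam2_def Lam1_def Lam_def)
  ultimately show ?thesis
    unfolding ev_nth_pairs
    by (intro sum.mono_neutral_cong_right) (auto simp: fund_u_def)
qed

text \<open>For \<open>d\<close> and \<open>(m, n)\<close>, the equation of the system is the coefficient \<open>N = m + n + d\<close> here; those
  with \<open>N < m + n\<close> vanish identically.\<close>

lemma linear_system_iff:
  "linear_system S a z c \<longleftrightarrow> (\<forall>(m, n)\<in>Lam1 7. \<forall>N<8.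
     fps_nth (\<Sum>k\<in>{-1..1}. \<Sum>l\<in>{-1..1}.
       Abs_fps (c k l) * ev (of_int k) (of_int l) (fund_u S a z m n)) N = 0)"
proof -
  define X where "X = (\<lambda>m n N. fps_nth (\<Sum>k\<in>{-1..1}. \<Sum>l\<in>{-1..1}.
       Abs_fps (c k l) * ev (of_int k) (of_int l) (fund_u S a z m n)) N)"
  define Y where "Y = (\<lambda>m n d. (\<Sum>k\<in>{-1..1}. \<Sum>l\<in>{-1..1}. c k l d * G_poly m n (of_int k) (of_int l)) +
        (\<Sum>k\<in>{-1..1}. \<Sum>l\<in>{-1..1}. \<Sum>s\<in>{0..<d}. c k l s *
             (\<Sum>(p, q)\<in>{(p, q)\<in>Lam2 7 - Lam2 (m + n). p + q = m + n + d - s}.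
                coef_u S a z p q m n / (fact p * fact q) * of_int k ^ p * of_int l ^ q)))"
  have X: "X m n N = (\<Sum>k\<in>{-1..1}. \<Sum>l\<in>{-1..1}. \<Sum>s=0..N.
      c k l s * fps_nth (ev (of_int k) (of_int l) (fund_u S a z m n)) (N - s))" for m n N
    by (simp add: X_def fps_sum_nth fps_mult_nth)
  have below: "X m n N = 0" if "N < m + n" for m n N
    using that by (simp add: X ev_fund_u_below)
  have XY: "X m n (m + n + d) = Y m n d" if "m \<le> 1" "m + n + d \<le> 7" for m n d
  proof -
    have "(\<Sum>s=0..m+n+d. c k l s * fps_nth (ev (of_int k) (of_int l) (fund_u S a z m n)) (m + n + d - s)) =
        c k l d * G_poly m n (of_int k) (of_int l) + (\<Sum>s\<in>{0..<d}. c k l s *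
             (\<Sum>(p, q)\<in>{(p, q)\<in>Lam2 7 - Lam2 (m + n). p + q = m + n + d - s}.
                coef_u S a z p q m n / (fact p * fact q) * of_int k ^ p * of_int l ^ q))" for k l
    proof -
      \<comment> \<open>For \<open>s > d\<close> the remaining index is below \<open>m + n\<close>,
        where the series has no terms; \<open>s = d\<close> hits its leading order and yields
        \<open>G_poly\<close>.\<close>
      have "(\<Sum>s=0..m+n+d. c k l s * fps_nth (ev (of_int k) (of_int l) (fund_u S a z m n)) (m + n + d - s)) =
          (\<Sum>s\<in>insert d {0..<d}. c k l s * fps_nth (ev (of_int k) (of_int l) (fund_u S a z m n)) (m + n + d - s))"
        by (rule sum.mono_neutral_right) (auto intro!: ev_fund_u_below)
      also have "\<dots> = c k l d * G_poly m n (of_int k) (of_int l) + (\<Sum>s\<in>{0..<d}. c k l s *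
          fps_nth (ev (of_int k) (of_int l) (fund_u S a z m n)) (m + n + d - s))"
        using that by (simp add: ev_fund_u_diagonal)
      finally show ?thesis
        using that by (simp add: ev_fund_u_above)
    qed
    thus ?thesis by (simp add: X Y_def sum.distrib)
  qed
  have "linear_system S a z c \<longleftrightarrow> (\<forall>d\<in>{0..7}. \<forall>(m, n)\<in>Lam1 (7 - d). Y m n d = 0)"
    unfolding linear_system_def Y_def by (intro ball_cong refl) (auto simp: eq_neg_iff_add_eq_0)
  also have "\<dots> \<longleftrightarrow> (\<forall>(m, n)\<in>Lam1 7. \<forall>N<8. X m n N = 0)"
  proof safe
    fix m n N assume *: "\<forall>d\<in>{0..7}. \<forall>(m, n)\<in>Lam1 (7 - d). Y m n d = 0" "(m, n) \<in> Lam1 7" "N < (8::nat)"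
    show "X m n N = 0"
    proof (cases "N < m + n")
      case False
      then obtain d where "N = m + n + d" by (metis le_iff_add not_less)
      thus ?thesis using * XY[of m n d] by (auto simp: Lam1_def Lam_def)
    qed (use below in simp)
  next
    fix d m n :: nat assume "\<forall>(m, n)\<in>Lam1 7. \<forall>N<8. X m n N = 0" "d \<in> {0..7}" "(m, n) \<in> Lam1 (7 - d)"
    thus "Y m n d = 0"
      using XY[of m n d] by (auto simp: Lam1_def Lam_def)
  qed
  finally show ?thesis by (simp add: X_def)
qed

text \<open>The orders \<open>N < 8\<close> covered by the system are exactly the powers of
  \<open>h\<close> in \<open>stencil_coef\<close>, so the sum vanishes for every \<open>h\<close>
  and not only up to a power of \<open>h\<close>.\<close>

lemma linear_system_sum_zero:
  assumes "linear_system S a z c"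
  shows "(\<Sum>k\<in>{-1..1}. \<Sum>l\<in>{-1..1}. stencil_coef c h k l) = 0"
proof -
  have one: "ev x y (fund_u S a z 0 0) = 1" for x y
  proof (rule fps_ext)
    fix N
    have "coef_u S a z p (N - p) 0 0 * x ^ p * y ^ (N - p) = (if p = 0 then if N = 0 then 1 else 0 else 0)" if "p \<le> N" for p
      using that by (auto simp: coef_u_0_0)
    hence "fps_nth (ev x y (fund_u S a z 0 0)) N = (\<Sum>p=0..N. if p = 0 then if N = 0 then 1 else 0 else 0)"
      unfolding ev_nth by (intro sum.cong refl) (auto simp: fund_u_def coef_u_0_0)
    thus "fps_nth (ev x y (fund_u S a z 0 0)) N = fps_nth 1 N"
      by simp
  qed
  have zero: "(\<Sum>k\<in>{-1..1}. \<Sum>l\<in>{-1..1}. c k l N) = 0" if "N < 8" for N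
    using assms that unfolding linear_system_iff
    by (force simp: Lam1_def Lam_def one fps_sum_nth)
  have "(\<Sum>k\<in>{-1..1}. \<Sum>l\<in>{-1..1}. stencil_coef c h k l) =
      (\<Sum>p\<in>{0..7}. (\<Sum>k\<in>{-1..1}. \<Sum>l\<in>{-1..1}. c k l p) * h ^ p)"
    unfolding stencil_coef_def sum_unit_range by (simp add: sum.distrib distrib_right)
  also have "\<dots> = 0"
    by (simp add: zero)
  finally show ?thesis .
qed

section \<open>Solutions of the linear system\<close>

text \<open>The convolution is a polynomial in \<open>t\<close> with leading coefficient
  \<open>c 0\<close>.\<close>

lemma eventually_geometric_convolution_pos:
  fixes c :: "nat \<Rightarrow> real"
  assumes "c 0 > 0"
  shows "eventually (\<lambda>t. (\<Sum>s=0..d. t ^ s * c (d - s)) > 0) at_top"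
proof -
  define P where "P = (\<lambda>d t. \<Sum>s=0..d. t ^ s * c (d - s))"
  have step: "P (Suc d) t = c (Suc d) + t * P d t" for d t
    unfolding P_def sum.atLeast0_atMost_Suc_shift by (simp add: sum_distrib_left mult.assoc)
  \<comment> \<open>The induction needs a lower bound independent of \<open>t\<close>: in the Horner
    step, bare positivity of \<open>P d t\<close> would not let \<open>t * P d t\<close> outweigh
    \<open>c (Suc d)\<close>.\<close>
  have "eventually (\<lambda>t. P d t \<ge> c 0) at_top"
  proof (induction d)
    case 0
    thus ?case by (simp add: P_def)
  next
    case (Suc d)
    have "eventually (\<lambda>t. t \<ge> max 0 ((c 0 - c (Suc d)) / c 0)) at_top"
      by (rule eventually_ge_at_top)
    with Suc show ?case
    proof eventually_elim
      case (elim t)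
      have "c 0 - c (Suc d) \<le> t * c 0"
        using elim(2) assms by (simp add: divide_simps)
      also have "\<dots> \<le> t * P d t"
        using elim by (intro mult_left_mono) auto
      finally show ?case by (simp add: step)
    qed
  qed
  thus ?thesis
    by (rule eventually_mono) (use assms in \<open>auto simp: P_def\<close>)
qed

text \<open>In \<open>Lap (\<beta> V)\<close> the cross term is twice the product of the gradients,
  and it matches the first-order terms when \<open>2 grad \<beta> = R \<beta>\<close>. The identity
  is exact; the three hypotheses control its defects.\<close>

lemma lap_conjugate:
  assumes "vanish 6 (R1 * \<beta> - (dx \<beta> + dx \<beta>))" "vanish 6 (R2 * \<beta> - (dy \<beta> + dy \<beta>))"
    and "vanish 6 (Q * \<beta> - lap \<beta>)" and V: "elim_op R1 R2 V = 0"
  shows "vanish 6 (lap (\<beta> * V) - Q * (\<beta> * V))"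
proof -
  have "lap (\<beta> * V) - Q * (\<beta> * V) = \<beta> * elim_op R1 R2 V - (Q * \<beta> - lap \<beta>) * V
      - (R1 * \<beta> - (dx \<beta> + dx \<beta>)) * dx V - (R2 * \<beta> - (dy \<beta> + dy \<beta>)) * dy V"
    by (simp add: elim_op_def lap_def dx_mult dy_mult dx_add dy_add algebra_simps)
  thus ?thesis
    unfolding V by (simp only: mult_zero_right) (intro vanish_diff vanish_mult_left vanish_0 assms)
qed

lemma linear_system_solution_exists:
  assumes "vanish 6 (egf (jet S z (\<lambda>w. partial_x a w / a w)) * \<beta> - (dx \<beta> + dx \<beta>))"
    and "vanish 6 (egf (jet S z (\<lambda>w. partial_y a w / a w)) * \<beta> - (dy \<beta> + dy \<beta>))"
    and "vanish 6 (Q * \<beta> - lap \<beta>)" and "cf \<beta> 0 0 > 0"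
  obtains c where "linear_system S a z c" "nontrivial c"
    "\<And>h. h > 0 \<Longrightarrow> stencil_coef c h 0 0 > 0"
    "\<And>h k l. h > 0 \<Longrightarrow> k \<in> {-1..1} \<Longrightarrow> l \<in> {-1..1} \<Longrightarrow> (k, l) \<noteq> (0, 0) \<Longrightarrow> stencil_coef c h k l \<le> 0"
proof -
  obtain B where B0: "\<And>k l. fps_nth (B k l) 0 = lap9 k l"
    and B: "\<And>W n. vanish 6 (lap W - Q * W) \<Longrightarrow> n < 8 \<Longrightarrow>
       fps_nth (\<Sum>k\<in>{-1..1}. \<Sum>l\<in>{-1..1}. B k l * ev (of_int k) (of_int l) W) n = 0"
    by (rule schroedinger_stencil_exists[where Q = Q]) blast
  define D where "D = (\<lambda>k l. B k l * ev (of_int k) (of_int l) \<beta>)"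
  have D0: "fps_nth (D k l) 0 = lap9 k l * cf \<beta> 0 0" for k l
    by (simp add: D_def fps_mult_nth B0 ev_nth)
  define E where "E = (\<lambda>t k l. Abs_fps (\<lambda>s. t ^ s) * - D k l)"
  \<comment> \<open>Finitely many conditions on \<open>t\<close>: each of the eight coefficients of
    every entry gets a strict sign. A polynomial whose coefficients share a sign has it for all
    \<open>h > 0\<close>, not only for small ones.\<close>
  have ev_pos: "eventually (\<lambda>t. \<forall>d\<in>{0..7}. \<forall>k\<in>{-1..1}. \<forall>l\<in>{-1..1}.
      (if k = 0 \<and> l = 0 then fps_nth (E t k l) d else - fps_nth (E t k l) d) > 0) at_top"
  proof (intro eventually_ball_finite ballI)
    fix d :: nat and k l :: int
    show "eventually (\<lambda>t. (if k = 0 \<and> l = 0 then fps_nth (E t k l) d else - fps_nth (E t k l) d) > 0) at_top"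
    proof (cases "k = 0 \<and> l = 0")
      case True
      thus ?thesis
        using eventually_geometric_convolution_pos[of "\<lambda>d. - fps_nth (D k l) d" d] assms(4)
        by (simp add: E_def fps_mult_nth D0 lap9_def sum_negf)
    next
      case False
      thus ?thesis
        using eventually_geometric_convolution_pos[of "\<lambda>d. fps_nth (D k l) d" d] assms(4)
        by (auto simp: E_def fps_mult_nth D0 lap9_def sum_negf)
    qed
  qed auto
  then obtain t where t: "\<And>d k l. d \<le> 7 \<Longrightarrow> k \<in> {-1..1} \<Longrightarrow> l \<in> {-1..1} \<Longrightarrow>
      (if k = 0 \<and> l = 0 then fps_nth (E t k l) d else - fps_nth (E t k l) d) > 0"
    using eventually_happens'[OF _ ev_pos] by fastforce
  define c where "c = (\<lambda>k l d. fps_nth (E t k l) d)"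
  have cE: "Abs_fps (c k l) = E t k l" for k l
    by (rule fps_ext) (simp add: c_def)
  have "fps_nth (\<Sum>k\<in>{-1..1}. \<Sum>l\<in>{-1..1}.
       Abs_fps (c k l) * ev (of_int k) (of_int l) (fund_u S a z m n)) N = 0" if "N < 8" for m n N
  proof -
    define W where "W = \<beta> * fund_u S a z m n"
    have W: "vanish 6 (lap W - Q * W)"
      unfolding W_def using assms(1-3) elim_op_fund_u by (rule lap_conjugate)
    have "(\<Sum>k\<in>{-1..1}. \<Sum>l\<in>{-1..1}. Abs_fps (c k l) * ev (of_int k) (of_int l) (fund_u S a z m n)) =
        - (Abs_fps (\<lambda>s. t ^ s) * (\<Sum>k\<in>{-1..1}. \<Sum>l\<in>{-1..1}. B k l * ev (of_int k) (of_int l) W))"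
      unfolding cE by (simp add: E_def D_def W_def ev_mult sum_distrib_left sum_negf mult_ac)
    thus ?thesis
      using B[OF W] that by (simp add: fps_mult_nth)
  qed
  hence "linear_system S a z c"
    by (auto simp: linear_system_iff)
  moreover have "nontrivial c"
    unfolding nontrivial_def c_def using t[of 0 0 0] by (intro bexI[of _ 0]) auto
  moreover have "stencil_coef c h 0 0 > 0" if "h > 0" for h
    unfolding stencil_coef_def c_def using t[of _ 0 0] that by (intro sum_pos mult_pos_pos) auto
  moreover have "stencil_coef c h k l \<le> 0"
    if "h > 0" "k \<in> {-1..1}" "l \<in> {-1..1}" "(k, l) \<noteq> (0, 0)" for h k l
  proof -
    have "c k l p \<le> 0" if "p \<le> 7" for p
      using t[of p k l] that \<open>k \<in> {-1..1}\<close> \<open>l \<in> {-1..1}\<close> \<open>(k, l) \<noteq> (0, 0)\<close>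
      by (auto simp: c_def split: if_splits)
    thus ?thesis
      unfolding stencil_coef_def using \<open>h > 0\<close> by (intro sum_nonpos mult_nonpos_nonneg) auto
  qed
  ultimately show ?thesis by (rule that)
qed

lemma poly_bigo_at_right_0:
  fixes P :: "real poly"
  assumes "\<And>n. n < N \<Longrightarrow> coeff P n = 0"
  shows "poly P \<in> O[at_right 0](\<lambda>h. h ^ N)"
proof -
  have "monom 1 N dvd P"
    using assms by (simp add: monom_1_dvd_iff')
  then obtain R where R: "P = monom 1 N * R" by (rule dvdE)
  have "(poly R \<longlongrightarrow> poly R 0) (at_right 0)"
    by (rule tendsto_intros)+
  hence "poly R \<in> O[at_right 0](\<lambda>_. 1)"
    by (intro bigoI_tendsto[where c = "poly R 0"]) auto
  hence "(\<lambda>h. h ^ N * poly R h) \<in> O[at_right 0](\<lambda>h. h ^ N * 1)"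
    by (intro landau_o.big.mult) auto
  moreover have "poly P = (\<lambda>h. h ^ N * poly R h)"
    by (auto simp: R poly_monom)
  ultimately show ?thesis by simp
qed

section \<open>Jets of functions at a boundary point\<close>

lemma partials_upto_mono:
  assumes "\<And>g. Q g \<Longrightarrow> Q' g"
  shows "partials_upto Q K S g \<Longrightarrow> partials_upto Q' K S g"
  by (induction K arbitrary: g) (auto simp: assms)

lemma partials_upto_Suc_imp: "partials_upto Q (Suc K) S g \<Longrightarrow> partials_upto Q K S g"
proof (induction K arbitrary: g)
  case (Suc K)
  have "Q g" "\<forall>(x, y)\<in>S. (\<lambda>t. g (t, y)) differentiable (at x) \<and> (\<lambda>t. g (x, t)) differentiable (at y)"
    "partials_upto Q (Suc K) S (partial_x g)" "partials_upto Q (Suc K) S (partial_y g)"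
    using Suc.prems by (subst (asm) partials_upto.simps(2), blast)+
  thus ?case
    using Suc.IH by (subst partials_upto.simps(2)) blast
qed simp

lemma partials_upto_le: "partials_upto Q K S g \<Longrightarrow> L \<le> K \<Longrightarrow> partials_upto Q L S g"
  by (induction K) (auto simp: le_Suc_eq dest: partials_upto_Suc_imp simp del: partials_upto.simps(2))

lemma partials_upto_base: "partials_upto Q K S g \<Longrightarrow> Q g"
  by (cases K) auto

lemma partials_upto_partial_x: "partials_upto Q (Suc K) S g \<Longrightarrow> partials_upto Q K S (partial_x g)"
  and partials_upto_partial_y: "partials_upto Q (Suc K) S g \<Longrightarrow> partials_upto Q K S (partial_y g)"
  by auto

lemma partial_x_DERIV:
  "partials_upto Q (Suc K) S g \<Longrightarrow> (x, y) \<in> S \<Longrightarrow>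
     ((\<lambda>t. g (t, y)) has_real_derivative partial_x g (x, y)) (at x)"
  and partial_y_DERIV:
  "partials_upto Q (Suc K) S g \<Longrightarrow> (x, y) \<in> S \<Longrightarrow>
     ((\<lambda>t. g (x, t)) has_real_derivative partial_y g (x, y)) (at y)"
  by (auto simp: partial_x_def partial_y_def DERIV_deriv_iff_real_differentiable)

lemma partial_x_eqI: "((\<lambda>t. g (t, y)) has_real_derivative D) (at x) \<Longrightarrow> partial_x g (x, y) = D"
  and partial_y_eqI: "((\<lambda>t. g (x, t)) has_real_derivative D) (at y) \<Longrightarrow> partial_y g (x, y) = D"
  by (auto simp: partial_x_def partial_y_def intro: DERIV_imp_deriv)

locale boundary_point =
  fixes S :: "(real \<times> real) set" and z :: "real \<times> real"
  assumes open_S: "open S" and z_closure: "z \<in> closure S"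
begin

text \<open>Only the limit at \<open>z\<close> is controlled. Unlike uniform continuity on
  \<open>S\<close>, this passes to \<open>1 / a\<close>, which may blow up at other boundary points
  of \<open>S\<close>.\<close>

definition extendable :: "(real \<times> real \<Rightarrow> real) \<Rightarrow> bool" where
  "extendable g \<longleftrightarrow> continuous_on S g \<and> (\<exists>L. (g \<longlongrightarrow> L) (at z within S))"

abbreviation smooth :: "nat \<Rightarrow> (real \<times> real \<Rightarrow> real) \<Rightarrow> bool" where
  "smooth K \<equiv> partials_upto extendable K S"

definition series :: "(real \<times> real \<Rightarrow> real) \<Rightarrow> real fps fps" where
  "series g = egf (jet S z g)"

lemma uc_imp_smooth: "uc_partials K S g \<Longrightarrow> smooth K g"
proof (erule partials_upto_mono[rotated])
  fix g :: "real \<times> real \<Rightarrow> real" assume "uniformly_continuous_on S g"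
  thus "extendable g"
    unfolding extendable_def
    using uniformly_continuous_imp_continuous uniformly_continuous_on_extension_at_closure[OF _ z_closure]
    by metis
qed

lemma nontrivial_limit: "at z within S \<noteq> bot"
proof -
  have "z islimpt S"
  proof (cases "z \<in> S")
    case True
    hence "z \<in> interior S" using open_S by (simp only: interior_open)
    thus ?thesis by (rule interior_limit_point)
  next
    case False
    thus ?thesis using z_closure unfolding closure_def by blast
  qed
  thus ?thesis by (simp only: trivial_limit_within not_not)
qed

lemma one_sided_eq:
  assumes "extendable g" "(g \<longlongrightarrow> L) (at z within S)"
  shows "one_sided S g z = L"
proof (cases "z \<in> S")
  case True
  have "(g \<longlongrightarrow> g z) (at z within S)"
    using assms(1) True unfolding extendable_def continuous_on_def by blast
  hence "g z = L" using tendsto_unique[OF nontrivial_limit] assms(2) by blast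
  thus ?thesis using True by (simp add: one_sided_def)
next
  case False
  thus ?thesis using tendsto_Lim[OF nontrivial_limit assms(2)] by (simp add: one_sided_def)
qed

lemma tendsto_one_sided:
  assumes "extendable g" shows "(g \<longlongrightarrow> one_sided S g z) (at z within S)"
  using assms one_sided_eq[OF assms] unfolding extendable_def by blast

lemma one_sided_cong: "(\<And>p. p \<in> S \<Longrightarrow> g p = g' p) \<Longrightarrow> one_sided S g z = one_sided S g' z"
proof -
  assume eq: "\<And>p. p \<in> S \<Longrightarrow> g p = g' p"
  hence "eventually (\<lambda>p. g p = g' p) (at z within S)"
    by (simp add: eventually_at_filter)
  thus ?thesis
    using eq Lim_cong[OF _ refl] by (auto simp: one_sided_def)
qed

lemma slices:
  assumes "(x, y) \<in> S"
  shows "eventually (\<lambda>t. (t, y) \<in> S) (nhds x)" "eventually (\<lambda>t. (x, t) \<in> S) (nhds y)"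
proof -
  have "open ((\<lambda>t. (t, y)) -` S)" "open ((\<lambda>t. (x, t)) -` S)"
    by (intro open_vimage open_S continuous_intros)+
  thus "eventually (\<lambda>t. (t, y) \<in> S) (nhds x)" "eventually (\<lambda>t. (x, t) \<in> S) (nhds y)"
    using assms unfolding eventually_nhds by (metis vimageE vimageI2)+
qed

lemma partial_cong:
  assumes "\<And>p. p \<in> S \<Longrightarrow> g p = g' p" "p \<in> S"
  shows "partial_x g p = partial_x g' p" "partial_y g p = partial_y g' p"
proof -
  obtain x y where p: "p = (x, y)" by (cases p)
  show "partial_x g p = partial_x g' p"
    unfolding p partial_x_def prod.case
    by (rule deriv_cong_ev) (use assms p in \<open>auto intro: eventually_mono[OF slices(1)]\<close>)
  show "partial_y g p = partial_y g' p"
    unfolding p partial_y_def prod.case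
    by (rule deriv_cong_ev) (use assms p in \<open>auto intro: eventually_mono[OF slices(2)]\<close>)
qed

lemma partial_x_iter_cong:
  "(\<And>p. p \<in> S \<Longrightarrow> g p = g' p) \<Longrightarrow> p \<in> S \<Longrightarrow> (partial_x ^^ m) g p = (partial_x ^^ m) g' p"
  by (induction m arbitrary: p) (auto intro: partial_cong)

lemma partial_y_iter_cong:
  "(\<And>p. p \<in> S \<Longrightarrow> g p = g' p) \<Longrightarrow> p \<in> S \<Longrightarrow> (partial_y ^^ m) g p = (partial_y ^^ m) g' p"
  by (induction m arbitrary: p) (auto intro: partial_cong)

lemma series_cong:
  assumes "\<And>p. p \<in> S \<Longrightarrow> g p = g' p" shows "series g = series g'"
proof -
  have "jet S z g m n = jet S z g' m n" for m n
    unfolding jet_def mixed_partial_def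
    by (intro one_sided_cong partial_x_iter_cong partial_y_iter_cong assms)
  hence "jet S z g = jet S z g'" by (intro ext)
  thus ?thesis by (simp add: series_def)
qed

lemma extendable_cong:
  assumes "\<And>p. p \<in> S \<Longrightarrow> g p = g' p" "extendable g" shows "extendable g'"
proof -
  have "(g \<longlongrightarrow> L) (at z within S) \<longleftrightarrow> (g' \<longlongrightarrow> L) (at z within S)" for L
    by (rule tendsto_cong) (use assms(1) in \<open>auto simp: eventually_at_filter intro!: always_eventually\<close>)
  thus ?thesis
    using assms continuous_on_cong[OF refl assms(1), of S "\<lambda>p. p"] unfolding extendable_def
    by (metis continuous_on_cong)
qed

lemma smooth_cong:
  assumes "\<And>p. p \<in> S \<Longrightarrow> g p = g' p" "smooth K g" shows "smooth K g'"
  using assms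
proof (induction K arbitrary: g g')
  case 0
  thus ?case using extendable_cong by auto
next
  case (Suc K)
  have "(\<lambda>t. g' (t, y)) differentiable (at x) \<and> (\<lambda>t. g' (x, t)) differentiable (at y)"
    if xy: "(x, y) \<in> S" for x y
  proof -
    have "((\<lambda>t. g' (t, y)) has_real_derivative partial_x g (x, y)) (at x)"
      using partial_x_DERIV[OF Suc.prems(2) xy]
      by (subst DERIV_cong_ev[OF refl _ refl, of _ "\<lambda>t. g (t, y)"])
        (use slices(1)[OF xy] Suc.prems in \<open>auto elim!: eventually_mono\<close>)
    moreover have "((\<lambda>t. g' (x, t)) has_real_derivative partial_y g (x, y)) (at y)"
      using partial_y_DERIV[OF Suc.prems(2) xy]
      by (subst DERIV_cong_ev[OF refl _ refl, of _ "\<lambda>t. g (x, t)"])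
        (use slices(2)[OF xy] Suc.prems in \<open>auto elim!: eventually_mono\<close>)
    ultimately show ?thesis
      by (auto simp: real_differentiable_def)
  qed
  moreover have "smooth K (partial_x g')"
    using Suc.IH[OF partial_cong(1)[OF Suc.prems(1)]] Suc.prems(2) by auto
  moreover have "smooth K (partial_y g')"
    using Suc.IH[OF partial_cong(2)[OF Suc.prems(1)]] Suc.prems(2) by auto
  moreover have "extendable g'"
    using extendable_cong Suc.prems partials_upto_base by blast
  ultimately show ?case by auto
qed

section \<open>Closure properties of smooth functions\<close>

lemma smooth_SucI:
  assumes "extendable g" "smooth K gx" "smooth K gy"
    and "\<And>x y. (x, y) \<in> S \<Longrightarrow> ((\<lambda>t. g (t, y)) has_real_derivative gx (x, y)) (at x)"
    and "\<And>x y. (x, y) \<in> S \<Longrightarrow> ((\<lambda>t. g (x, t)) has_real_derivative gy (x, y)) (at y)"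
  shows "smooth (Suc K) g"
proof -
  have "smooth K (partial_x g)"
    by (rule smooth_cong[OF _ assms(2)]) (use assms(4) in \<open>auto intro!: partial_x_eqI[symmetric]\<close>)
  moreover have "smooth K (partial_y g)"
    by (rule smooth_cong[OF _ assms(3)]) (use assms(5) in \<open>auto intro!: partial_y_eqI[symmetric]\<close>)
  moreover have "(\<lambda>t. g (t, y)) differentiable (at x) \<and> (\<lambda>t. g (x, t)) differentiable (at y)"
    if "(x, y) \<in> S" for x y
    using assms(4,5)[OF that] by (auto simp: real_differentiable_def)
  ultimately show ?thesis
    using assms(1) by auto
qed

lemma partial_add:
  assumes "smooth (Suc K) g" "smooth (Suc K) h" "p \<in> S"
  shows "partial_x (\<lambda>p. g p + h p) p = partial_x g p + partial_x h p"
    and "partial_y (\<lambda>p. g p + h p) p = partial_y g p + partial_y h p"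
proof -
  obtain x y where p: "p = (x, y)" by (cases p)
  show "partial_x (\<lambda>p. g p + h p) p = partial_x g p + partial_x h p"
    unfolding p
    by (rule partial_x_eqI DERIV_add partial_x_DERIV[OF assms(1)] partial_x_DERIV[OF assms(2)] | use assms(3) p in blast)+
  show "partial_y (\<lambda>p. g p + h p) p = partial_y g p + partial_y h p"
    unfolding p
    by (rule partial_y_eqI DERIV_add partial_y_DERIV[OF assms(1)] partial_y_DERIV[OF assms(2)] | use assms(3) p in blast)+
qed

lemma partial_mult:
  assumes "smooth (Suc K) g" "smooth (Suc K) h" "p \<in> S"
  shows "partial_x (\<lambda>p. g p * h p) p = partial_x g p * h p + partial_x h p * g p"
    and "partial_y (\<lambda>p. g p * h p) p = partial_y g p * h p + partial_y h p * g p"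
proof -
  obtain x y where p: "p = (x, y)" by (cases p)
  show "partial_x (\<lambda>p. g p * h p) p = partial_x g p * h p + partial_x h p * g p"
    unfolding p
    by (rule partial_x_eqI DERIV_mult partial_x_DERIV[OF assms(1)] partial_x_DERIV[OF assms(2)] | use assms(3) p in blast)+
  show "partial_y (\<lambda>p. g p * h p) p = partial_y g p * h p + partial_y h p * g p"
    unfolding p
    by (rule partial_y_eqI DERIV_mult partial_y_DERIV[OF assms(1)] partial_y_DERIV[OF assms(2)] | use assms(3) p in blast)+
qed

lemma extendable_add: "extendable g \<Longrightarrow> extendable h \<Longrightarrow> extendable (\<lambda>p. g p + h p)"
  unfolding extendable_def by (metis continuous_on_add tendsto_add)

lemma extendable_mult: "extendable g \<Longrightarrow> extendable h \<Longrightarrow> extendable (\<lambda>p. g p * h p)"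
  unfolding extendable_def by (metis continuous_on_mult tendsto_mult)

lemma smooth_const: "smooth K (\<lambda>_. c)"
proof (induction K arbitrary: c)
  case 0
  show ?case by (auto simp: extendable_def)
next
  case (Suc K)
  show ?case
    by (rule smooth_SucI[OF _ Suc[of 0] Suc[of 0]]) (auto simp: extendable_def)
qed

lemma smooth_add: "smooth K g \<Longrightarrow> smooth K h \<Longrightarrow> smooth K (\<lambda>p. g p + h p)"
proof (induction K arbitrary: g h)
  case 0
  thus ?case by (simp add: extendable_add)
next
  case (Suc K)
  show ?case
  proof (rule smooth_SucI)
    show "extendable (\<lambda>p. g p + h p)"
      using Suc.prems by (intro extendable_add partials_upto_base)
    show "smooth K (\<lambda>p. partial_x g p + partial_x h p)" "smooth K (\<lambda>p. partial_y g p + partial_y h p)"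
      using Suc by auto
    show "((\<lambda>t. g (t, y) + h (t, y)) has_real_derivative partial_x g (x, y) + partial_x h (x, y)) (at x)"
      "((\<lambda>t. g (x, t) + h (x, t)) has_real_derivative partial_y g (x, y) + partial_y h (x, y)) (at y)"
      if "(x, y) \<in> S" for x y
      using DERIV_add[OF partial_x_DERIV[OF Suc.prems(1) that] partial_x_DERIV[OF Suc.prems(2) that]]
        DERIV_add[OF partial_y_DERIV[OF Suc.prems(1) that] partial_y_DERIV[OF Suc.prems(2) that]] by -
  qed
qed

lemma smooth_mult: "smooth K g \<Longrightarrow> smooth K h \<Longrightarrow> smooth K (\<lambda>p. g p * h p)"
proof (induction K arbitrary: g h)
  case 0
  thus ?case by (simp add: extendable_mult)
next
  case (Suc K)
  have K: "smooth K g" "smooth K h"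
    using Suc.prems partials_upto_Suc_imp by blast+
  show ?case
  proof (rule smooth_SucI)
    show "extendable (\<lambda>p. g p * h p)"
      using Suc.prems by (intro extendable_mult partials_upto_base)
    show "smooth K (\<lambda>p. partial_x g p * h p + partial_x h p * g p)"
      "smooth K (\<lambda>p. partial_y g p * h p + partial_y h p * g p)"
      using Suc K by (auto intro!: smooth_add)
    show "((\<lambda>t. g (t, y) * h (t, y)) has_real_derivative partial_x g (x, y) * h (x, y) + partial_x h (x, y) * g (x, y)) (at x)"
      "((\<lambda>t. g (x, t) * h (x, t)) has_real_derivative partial_y g (x, y) * h (x, y) + partial_y h (x, y) * g (x, y)) (at y)"
      if "(x, y) \<in> S" for x y
      using DERIV_mult[OF partial_x_DERIV[OF Suc.prems(1) that] partial_x_DERIV[OF Suc.prems(2) that]]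
        DERIV_mult[OF partial_y_DERIV[OF Suc.prems(1) that] partial_y_DERIV[OF Suc.prems(2) that]] by -
  qed
qed

lemma smooth_power: "smooth K g \<Longrightarrow> smooth K (\<lambda>p. g p ^ n)"
  by (induction n) (auto intro: smooth_const smooth_mult)

text \<open>A bootstrap that applies to \<open>1 / a\<close> and \<open>1 / \<surd>a\<close>, whose gradients are \<open>- g\<^sup>2 \<nabla>a\<close> and
  \<open>- g\<^sup>3 \<nabla>a / 2\<close>.\<close>

lemma smooth_of_gradient_eq:
  assumes "extendable g" "smooth K a"
    and "\<And>x y. (x, y) \<in> S \<Longrightarrow>
      ((\<lambda>t. g (t, y)) has_real_derivative c * (partial_x a (x, y) * g (x, y) ^ n)) (at x)"
    and "\<And>x y. (x, y) \<in> S \<Longrightarrow>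
      ((\<lambda>t. g (x, t)) has_real_derivative c * (partial_y a (x, y) * g (x, y) ^ n)) (at y)"
  shows "smooth K g"
  using assms(2)
proof (induction K)
  case 0
  thus ?case using assms(1) by simp
next
  case (Suc K)
  hence "smooth K g" using partials_upto_Suc_imp by blast
  show ?case
  proof (rule smooth_SucI[OF assms(1)])
    show "smooth K (\<lambda>p. c * (partial_x a p * g p ^ n))" "smooth K (\<lambda>p. c * (partial_y a p * g p ^ n))"
      using Suc \<open>smooth K g\<close> by (auto intro!: smooth_mult smooth_const smooth_power)
  qed (rule assms(3,4); assumption)+
qed

text \<open>Schwarz's theorem, by two mean-value evaluations of one second difference. It is
  required because \<open>mixed_partial\<close> fixes an order, taking the derivatives in
  \<open>y\<close> before those in \<open>x\<close>.\<close>

lemma mixed_partials_commute: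
  assumes "smooth 2 g" "p \<in> S"
  shows "partial_x (partial_y g) p = partial_y (partial_x g) p"
proof (rule ccontr)
  assume neq: "partial_x (partial_y g) p \<noteq> partial_y (partial_x g) p"
  define e where "e = dist (partial_x (partial_y g) p) (partial_y (partial_x g) p) / 2"
  have "e > 0" using neq by (simp add: e_def)
  obtain x y where p: "p = (x, y)" by (cases p)
  have g2: "smooth (Suc (Suc 0)) g" using assms(1) by (simp only: numeral_2_eq_2)
  hence gx: "smooth (Suc 0) (partial_x g)" and gy: "smooth (Suc 0) (partial_y g)" by auto
  have near: "eventually (\<lambda>w. dist (k w) (k p) < e) (nhds p)" if "extendable k" for k
  proof -
    have "isCont k p"
      using that open_S assms(2) by (simp add: extendable_def continuous_on_eq_continuous_at)
    hence "(k \<longlongrightarrow> k p) (nhds p)"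
      by (simp add: isCont_def tendsto_at_iff_tendsto_nhds)
    thus ?thesis using \<open>e > 0\<close> by (rule tendstoD)
  qed
  have "eventually (\<lambda>w. dist (partial_x (partial_y g) w) (partial_x (partial_y g) p) < e) (nhds p)"
    "eventually (\<lambda>w. dist (partial_y (partial_x g) w) (partial_y (partial_x g) p) < e) (nhds p)"
    by (rule near; use g2 in simp)+
  moreover have "eventually (\<lambda>w. w \<in> S) (nhds p)"
    using open_S assms(2) by (rule eventually_nhds_in_open)
  ultimately have "eventually (\<lambda>w. w \<in> S \<and> dist (partial_x (partial_y g) w) (partial_x (partial_y g) p) < e
      \<and> dist (partial_y (partial_x g) w) (partial_y (partial_x g) p) < e) (nhds p)"
    by eventually_elim auto
  then obtain r where "r > 0" and r: "\<And>w. dist w p < r \<Longrightarrow> w \<in> S \<and>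
      dist (partial_x (partial_y g) w) (partial_x (partial_y g) p) < e
      \<and> dist (partial_y (partial_x g) w) (partial_y (partial_x g) p) < e"
    unfolding eventually_nhds_metric by blast
  define h where "h = r / 3"
  have "h > 0" using \<open>r > 0\<close> by (simp add: h_def)
  have box: "dist (s, t) p < r" if "x \<le> s" "s \<le> x + h" "y \<le> t" "t \<le> y + h" for s t
  proof -
    have "dist (s, t) p \<le> dist s x + dist t y"
      unfolding p dist_Pair_Pair by (rule sqrt_sum_squares_le_sum) auto
    also have "\<dots> \<le> h + h" using that by (auto simp: dist_real_def)
    also have "\<dots> < r" using \<open>r > 0\<close> by (simp add: h_def)
    finally show ?thesis .
  qed
  have S: "(s, t) \<in> S" if "x \<le> s" "s \<le> x + h" "y \<le> t" "t \<le> y + h" for s t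
    using r box that by blast
  define \<Delta> where "\<Delta> = g (x + h, y + h) - g (x + h, y) - (g (x, y + h) - g (x, y))"
  have D1: "((\<lambda>t. g (t, y + h) - g (t, y)) has_real_derivative
      partial_x g (s, y + h) - partial_x g (s, y)) (at s)" if "x \<le> s" "s \<le> x + h" for s
    using S that \<open>h > 0\<close> by (intro DERIV_diff partial_x_DERIV[OF g2]) auto
  have D2: "((\<lambda>t. partial_x g (s, t)) has_real_derivative partial_y (partial_x g) (s, t)) (at t)"
    if "x \<le> s" "s \<le> x + h" "y \<le> t" "t \<le> y + h" for s t
    using S that by (intro partial_y_DERIV[OF gx])
  have D3: "((\<lambda>t. g (x + h, t) - g (x, t)) has_real_derivative
      partial_y g (x + h, t) - partial_y g (x, t)) (at t)" if "y \<le> t" "t \<le> y + h" for t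
    using S that \<open>h > 0\<close> by (intro DERIV_diff partial_y_DERIV[OF g2]) auto
  have D4: "((\<lambda>t. partial_y g (t, w)) has_real_derivative partial_x (partial_y g) (s, w)) (at s)"
    if "x \<le> s" "s \<le> x + h" "y \<le> w" "w \<le> y + h" for s w
    using S that by (intro partial_x_DERIV[OF gy])
  obtain \<xi> where \<xi>: "x < \<xi>" "\<xi> < x + h"
    and "\<Delta> = (x + h - x) * (partial_x g (\<xi>, y + h) - partial_x g (\<xi>, y))"
    unfolding \<Delta>_def
    using MVT2[of x "x + h" "\<lambda>t. g (t, y + h) - g (t, y)" "\<lambda>t. partial_x g (t, y + h) - partial_x g (t, y)"]
      \<open>h > 0\<close> D1 by auto
  moreover obtain \<eta> where \<eta>: "y < \<eta>" "\<eta> < y + h"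
    and "partial_x g (\<xi>, y + h) - partial_x g (\<xi>, y) = (y + h - y) * partial_y (partial_x g) (\<xi>, \<eta>)"
    using MVT2[of y "y + h" "\<lambda>t. partial_x g (\<xi>, t)" "\<lambda>t. partial_y (partial_x g) (\<xi>, t)"]
      \<open>h > 0\<close> D2[of \<xi>] \<xi> by auto
  ultimately have 1: "\<Delta> = h * h * partial_y (partial_x g) (\<xi>, \<eta>)" by simp
  obtain \<eta>' where \<eta>': "y < \<eta>'" "\<eta>' < y + h"
    and "g (x + h, y + h) - g (x, y + h) - (g (x + h, y) - g (x, y)) =
      (y + h - y) * (partial_y g (x + h, \<eta>') - partial_y g (x, \<eta>'))"
    using MVT2[of y "y + h" "\<lambda>t. g (x + h, t) - g (x, t)" "\<lambda>t. partial_y g (x + h, t) - partial_y g (x, t)"]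
      \<open>h > 0\<close> D3 by auto
  moreover obtain \<xi>' where \<xi>': "x < \<xi>'" "\<xi>' < x + h"
    and "partial_y g (x + h, \<eta>') - partial_y g (x, \<eta>') = (x + h - x) * partial_x (partial_y g) (\<xi>', \<eta>')"
    using MVT2[of x "x + h" "\<lambda>t. partial_y g (t, \<eta>')" "\<lambda>t. partial_x (partial_y g) (t, \<eta>')"]
      \<open>h > 0\<close> D4[of _ \<eta>'] \<eta>' by auto
  ultimately have 2: "\<Delta> = h * h * partial_x (partial_y g) (\<xi>', \<eta>')"
    by (simp add: \<Delta>_def)
  have "partial_y (partial_x g) (\<xi>, \<eta>) = partial_x (partial_y g) (\<xi>', \<eta>')"
    using 1 2 \<open>h > 0\<close> by simp
  moreover have "dist (partial_y (partial_x g) (\<xi>, \<eta>)) (partial_y (partial_x g) p) < e"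
    "dist (partial_x (partial_y g) (\<xi>', \<eta>')) (partial_x (partial_y g) p) < e"
    using r box \<xi> \<eta> \<xi>' \<eta>' by auto
  ultimately have "dist (partial_x (partial_y g) p) (partial_y (partial_x g) p) <
      dist (partial_x (partial_y g) p) (partial_y (partial_x g) p)"
    unfolding e_def by (metis dist_commute dist_triangle_half_r)
  thus False by simp
qed

lemma partial_y_iter_partial_x:
  "smooth (Suc n) g \<Longrightarrow> p \<in> S \<Longrightarrow> (partial_y ^^ n) (partial_x g) p = partial_x ((partial_y ^^ n) g) p"
proof (induction n arbitrary: g p)
  case (Suc n)
  have g: "smooth 2 g"
    using Suc.prems(1) by (rule partials_upto_le) simp
  have "(partial_y ^^ Suc n) (partial_x g) p = (partial_y ^^ n) (partial_y (partial_x g)) p"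
    by (simp add: funpow_swap1)
  also have "\<dots> = (partial_y ^^ n) (partial_x (partial_y g)) p"
    by (rule partial_y_iter_cong) (simp_all add: mixed_partials_commute[OF g] Suc.prems)
  also have "\<dots> = partial_x ((partial_y ^^ n) (partial_y g)) p"
    using Suc.prems by (intro Suc.IH partials_upto_partial_y)
  finally show ?case by (simp add: funpow_swap1)
qed auto

text \<open>Jets of order beyond the regularity of a function are junk values, so that identities between
  functions only carry over to series modulo a power of the maximal ideal.\<close>

definition agree :: "nat \<Rightarrow> real fps fps \<Rightarrow> real fps fps \<Rightarrow> bool" where
  "agree N P P' \<longleftrightarrow> vanish N (P - P')"

lemma agree_refl [simp]: "agree N P P"
  by (simp add: agree_def)

lemma agree_sym: "agree N P P' \<Longrightarrow> agree N P' P"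
  unfolding agree_def using vanish_minus[of N "P - P'"] by simp

lemma agree_trans [trans]: "agree N P P' \<Longrightarrow> agree N P' P'' \<Longrightarrow> agree N P P''"
  unfolding agree_def using vanish_add[of N "P - P'" "P' - P''"] by simp

lemma agree_mono: "agree N P P' \<Longrightarrow> M \<le> N \<Longrightarrow> agree M P P'"
  unfolding agree_def by (rule vanish_mono)

lemma agree_add: "agree N P P' \<Longrightarrow> agree N R R' \<Longrightarrow> agree N (P + R) (P' + R')"
  unfolding agree_def using vanish_add[of N "P - P'" "R - R'"] by (simp add: algebra_simps)

lemma agree_mult: "agree N P P' \<Longrightarrow> agree N R R' \<Longrightarrow> agree N (P * R) (P' * R')"
proof -
  assume *: "agree N P P'" "agree N R R'"
  have "P * R - P' * R' = (P - P') * R + P' * (R - R')" by (simp add: algebra_simps)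
  thus ?thesis
    using * by (simp add: agree_def vanish_add vanish_mult_left vanish_mult_right)
qed

lemma agree_dx: "agree (Suc N) P P' \<Longrightarrow> agree N (dx P) (dx P')"
  unfolding agree_def using vanish_dx[of N "P - P'"] by (simp add: dx_diff)

lemma agree_SucI:
  "cf P 0 0 = cf P' 0 0 \<Longrightarrow> agree N (dx P) (dx P') \<Longrightarrow> agree N (dy P) (dy P') \<Longrightarrow> agree (Suc N) P P'"
  unfolding agree_def by (rule vanish_SucI) (simp_all add: dx_diff dy_diff)

section \<open>Taylor series of derivatives, sums and products\<close>

lemma cf_series_0_0: "cf (series g) 0 0 = one_sided S g z"
  by (simp add: series_def jet_def mixed_partial_def)

lemma dy_series: "dy (series g) = series (partial_y g)"
proof (rule cf_eqI)
  fix p q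
  have "real q + 1 \<noteq> 0" by linarith
  moreover have "jet S z g p (Suc q) = jet S z (partial_y g) p q"
    by (simp add: jet_def mixed_partial_def funpow_swap1)
  ultimately show "cf (dy (series g)) p q = cf (series (partial_y g)) p q"
    by (simp add: series_def divide_simps)
qed

text \<open>The additional derivative in \<open>x\<close> has to pass the derivatives in
  \<open>y\<close>, which uses up regularity; hence the truncation at \<open>K\<close>, whereas
  \<open>dy_series\<close> is exact.\<close>

lemma dx_series:
  assumes "smooth K g" shows "agree K (dx (series g)) (series (partial_x g))"
  unfolding agree_def vanish_def
proof (intro allI impI)
  fix p q assume "p + q < K"
  hence "smooth (Suc q) g"
    by (intro partials_upto_le[OF assms]) simp
  hence "jet S z (partial_x g) p q = one_sided S ((partial_x ^^ p) (partial_x ((partial_y ^^ q) g))) z"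
    unfolding jet_def mixed_partial_def
    by (intro one_sided_cong partial_x_iter_cong partial_y_iter_partial_x)
  hence "jet S z g (Suc p) q = jet S z (partial_x g) p q"
    by (simp add: jet_def mixed_partial_def funpow_swap1)
  moreover have "real p + 1 \<noteq> 0" by linarith
  ultimately show "cf (dx (series g) - series (partial_x g)) p q = 0"
    by (simp add: series_def divide_simps)
qed

lemma series_add:
  "smooth K g \<Longrightarrow> smooth K h \<Longrightarrow> agree (Suc K) (series (\<lambda>p. g p + h p)) (series g + series h)"
proof (induction K arbitrary: g h)
  case 0
  hence "extendable g" "extendable h" by auto
  hence "one_sided S (\<lambda>p. g p + h p) z = one_sided S g z + one_sided S h z"
    by (intro one_sided_eq extendable_add tendsto_add tendsto_one_sided)
  thus ?case
    using cf_series_0_0 by (simp add: agree_def vanish_def)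
next
  case (Suc K)
  hence ext: "extendable g" "extendable h" by auto
  have eq: "partial_x (\<lambda>p. g p + h p) p = partial_x g p + partial_x h p"
    "partial_y (\<lambda>p. g p + h p) p = partial_y g p + partial_y h p" if "p \<in> S" for p
    by (rule partial_add[OF Suc.prems that])+
  show ?case
  proof (rule agree_SucI)
    show "cf (series (\<lambda>p. g p + h p)) 0 0 = cf (series g + series h) 0 0"
      unfolding cf_series_0_0 fps_add_nth
      by (intro one_sided_eq extendable_add tendsto_add tendsto_one_sided ext)
    have "agree (Suc K) (dx (series (\<lambda>p. g p + h p))) (series (partial_x (\<lambda>p. g p + h p)))"
      using Suc.prems by (intro dx_series smooth_add)
    also have "series (partial_x (\<lambda>p. g p + h p)) = series (\<lambda>p. partial_x g p + partial_x h p)"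
      by (rule series_cong) (rule eq)
    also have "agree (Suc K) \<dots> (series (partial_x g) + series (partial_x h))"
      using Suc.prems by (intro Suc.IH partials_upto_partial_x)
    also have "agree (Suc K) \<dots> (dx (series g) + dx (series h))"
      using Suc.prems by (intro agree_add agree_sym[OF dx_series])
    finally show "agree (Suc K) (dx (series (\<lambda>p. g p + h p))) (dx (series g + series h))"
      by (simp add: dx_add)
    have "dy (series (\<lambda>p. g p + h p)) = series (\<lambda>p. partial_y g p + partial_y h p)"
      unfolding dy_series by (rule series_cong) (rule eq)
    also have "agree (Suc K) \<dots> (series (partial_y g) + series (partial_y h))"
      using Suc.prems by (intro Suc.IH partials_upto_partial_y)
    finally show "agree (Suc K) (dy (series (\<lambda>p. g p + h p))) (dy (series g + series h))"
      by (simp add: dy_add dy_series)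
  qed
qed

text \<open>Constant terms multiply as limits, and the first derivatives are handled by the product
  rule and the induction hypothesis. Coefficients of order \<open>K\<close> itself are still
  meaningful, hence \<open>Suc K\<close>.\<close>

lemma series_mult:
  "smooth K g \<Longrightarrow> smooth K h \<Longrightarrow> agree (Suc K) (series (\<lambda>p. g p * h p)) (series g * series h)"
proof (induction K arbitrary: g h)
  case 0
  hence "extendable g" "extendable h" by auto
  hence "one_sided S (\<lambda>p. g p * h p) z = one_sided S g z * one_sided S h z"
    by (intro one_sided_eq extendable_mult tendsto_mult tendsto_one_sided)
  thus ?case
    using cf_series_0_0 by (simp add: agree_def vanish_def cf_mult)
next
  case (Suc K)
  hence ext: "extendable g" "extendable h" by auto
  have K: "smooth K g" "smooth K h"
    using Suc.prems partials_upto_Suc_imp by blast+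
  have eq: "partial_x (\<lambda>p. g p * h p) p = partial_x g p * h p + partial_x h p * g p"
    "partial_y (\<lambda>p. g p * h p) p = partial_y g p * h p + partial_y h p * g p" if "p \<in> S" for p
    by (rule partial_mult[OF Suc.prems that])+
  show ?case
  proof (rule agree_SucI)
    show "cf (series (\<lambda>p. g p * h p)) 0 0 = cf (series g * series h) 0 0"
      unfolding cf_mult
      by (simp add: cf_series_0_0)
        (intro one_sided_eq extendable_mult tendsto_mult tendsto_one_sided ext)
    have "agree (Suc K) (dx (series (\<lambda>p. g p * h p))) (series (partial_x (\<lambda>p. g p * h p)))"
      using Suc.prems by (intro dx_series smooth_mult)
    also have "series (partial_x (\<lambda>p. g p * h p)) = series (\<lambda>p. partial_x g p * h p + partial_x h p * g p)"
      by (rule series_cong) (rule eq)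
    also have "agree (Suc K) \<dots> (series (\<lambda>p. partial_x g p * h p) + series (\<lambda>p. partial_x h p * g p))"
      using Suc.prems K by (intro series_add smooth_mult partials_upto_partial_x)
    also have "agree (Suc K) \<dots> (series (partial_x g) * series h + series (partial_x h) * series g)"
      using Suc.prems K by (intro agree_add Suc.IH partials_upto_partial_x)
    also have "agree (Suc K) \<dots> (dx (series g) * series h + dx (series h) * series g)"
      using Suc.prems by (intro agree_add agree_mult agree_refl agree_sym[OF dx_series])
    finally show "agree (Suc K) (dx (series (\<lambda>p. g p * h p))) (dx (series g * series h))"
      by (simp add: dx_mult algebra_simps)
    have "dy (series (\<lambda>p. g p * h p)) = series (\<lambda>p. partial_y g p * h p + partial_y h p * g p)"
      unfolding dy_series by (rule series_cong) (rule eq)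
    also have "agree (Suc K) \<dots> (series (\<lambda>p. partial_y g p * h p) + series (\<lambda>p. partial_y h p * g p))"
      using Suc.prems K by (intro series_add smooth_mult partials_upto_partial_y)
    also have "agree (Suc K) \<dots> (series (partial_y g) * series h + series (partial_y h) * series g)"
      using Suc.prems K by (intro agree_add Suc.IH partials_upto_partial_y)
    finally show "agree (Suc K) (dy (series (\<lambda>p. g p * h p))) (dy (series g * series h))"
      by (simp add: dy_mult dy_series algebra_simps)
  qed
qed

lemma series_const: "series (\<lambda>_. c) = fps_const (fps_const c)"
proof (rule cf_eqI)
  fix p q
  have "(partial_y ^^ n) (\<lambda>_. c) = (\<lambda>_. if n = 0 then c else 0)" for n
    by (induction n) (auto simp: partial_y_def fun_eq_iff)
  moreover have "(partial_x ^^ m) (\<lambda>_. d) = (\<lambda>_. if m = 0 then d else 0)" for m d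
    by (induction m) (auto simp: partial_x_def fun_eq_iff)
  ultimately have "jet S z (\<lambda>_. c) p q = one_sided S (\<lambda>_. if p = 0 then if q = 0 then c else 0 else 0) z"
    by (simp add: jet_def mixed_partial_def)
  also have "\<dots> = (if p = 0 then if q = 0 then c else 0 else 0)"
    by (intro one_sided_eq) (auto simp: extendable_def)
  finally show "cf (series (\<lambda>_. c)) p q = cf (fps_const (fps_const c)) p q"
    by (simp add: series_def)
qed

end

section \<open>The jets of the coefficient and of the exact solution\<close>

definition smult2 :: "real \<Rightarrow> real fps fps \<Rightarrow> real fps fps" where
  "smult2 x P = fps_const (fps_const x) * P"

lemma cf_smult2 [simp]: "cf (smult2 x P) p q = x * cf P p q"
  by (simp add: smult2_def)

lemma cf_sum: "cf (sum P I) p q = (\<Sum>i\<in>I. cf (P i) p q)"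
  by (simp add: fps_sum_nth)

lemma elim_op_add: "elim_op R1 R2 (P + P') = elim_op R1 R2 P + elim_op R1 R2 P'"
  by (simp add: elim_op_def lap_def dx_add dy_add algebra_simps)

lemma elim_op_diff: "elim_op R1 R2 (P - P') = elim_op R1 R2 P - elim_op R1 R2 P'"
  by (simp add: elim_op_def lap_def dx_diff dy_diff algebra_simps)

lemma elim_op_smult2: "elim_op R1 R2 (smult2 x P) = smult2 x (elim_op R1 R2 P)"
proof -
  have "dx (smult2 x P) = smult2 x (dx P)" "dy (smult2 x P) = smult2 x (dy P)" for P
    by (rule cf_eqI; simp)+
  thus ?thesis
    by (simp add: elim_op_def lap_def) (simp add: smult2_def algebra_simps)
qed

lemma elim_op_0: "elim_op R1 R2 0 = 0"
  using elim_op_diff[of R1 R2 0 0] by simp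

lemma elim_op_sum: "elim_op R1 R2 (sum P I) = (\<Sum>i\<in>I. elim_op R1 R2 (P i))"
  by (induction I rule: infinite_finite_induct) (simp_all add: elim_op_0 elim_op_add)

lemma finite_Lam [simp]: "finite (Lam K)"
  by (rule finite_subset[of _ "{..K} \<times> {..K}"]) (auto simp: Lam_def)

lemma finite_Lam1 [simp]: "finite (Lam1 K)"
  by (rule finite_subset[of _ "Lam K"]) (auto simp: Lam1_def)

context boundary_point
begin

context
  fixes a :: "real \<times> real \<Rightarrow> real"
  assumes a_smooth: "smooth 6 a"
    and a_pos: "\<And>p. p \<in> S \<Longrightarrow> a p > 0" and a_pos_z: "one_sided S a z > 0"
begin

lemma a_smooth_Suc: "smooth (Suc 5) a"
  using a_smooth by simp

lemma a_extendable: "extendable a"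
  using a_smooth by (rule partials_upto_base)

lemma inverse_smooth: "smooth 6 (\<lambda>w. 1 / a w)"
proof (rule smooth_of_gradient_eq[OF _ a_smooth, where c = "-1" and n = 2])
  have "((\<lambda>w. 1 / a w) \<longlongrightarrow> 1 / one_sided S a z) (at z within S)"
    using a_pos_z tendsto_one_sided[OF a_extendable] by (intro tendsto_intros) auto
  thus "extendable (\<lambda>w. 1 / a w)"
    using a_extendable a_pos unfolding extendable_def by (force intro!: continuous_intros)
next
  fix x y assume xy: "(x, y) \<in> S"
  hence "a (x, y) > 0" by (rule a_pos)
  thus "((\<lambda>t. 1 / a (t, y)) has_real_derivative - 1 * (partial_x a (x, y) * (1 / a (x, y)) ^ 2)) (at x)"
    "((\<lambda>t. 1 / a (x, t)) has_real_derivative - 1 * (partial_y a (x, y) * (1 / a (x, y)) ^ 2)) (at y)"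
    using partial_x_DERIV[OF a_smooth_Suc xy] partial_y_DERIV[OF a_smooth_Suc xy]
    by (auto intro!: derivative_eq_intros simp: power2_eq_square)
qed

lemma inverse_sqrt_smooth: "smooth 6 (\<lambda>w. 1 / sqrt (a w))"
proof (rule smooth_of_gradient_eq[OF _ a_smooth, where c = "-1/2" and n = 3])
  have "((\<lambda>w. 1 / sqrt (a w)) \<longlongrightarrow> 1 / sqrt (one_sided S a z)) (at z within S)"
    using a_pos_z tendsto_one_sided[OF a_extendable] by (intro tendsto_intros) auto
  thus "extendable (\<lambda>w. 1 / sqrt (a w))"
    using a_extendable a_pos unfolding extendable_def by (force intro!: continuous_intros)
next
  fix x y assume xy: "(x, y) \<in> S"
  hence pos: "a (x, y) > 0" by (rule a_pos)
  have d: "((\<lambda>t. 1 / sqrt (b t)) has_real_derivative -1/2 * (D * (1 / sqrt (b s)) ^ 3)) (at s)"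
    if "(b has_real_derivative D) (at s)" "b s > 0" for b D s
    using that by (auto intro!: derivative_eq_intros simp: power3_eq_cube field_simps)
  show "((\<lambda>t. 1 / sqrt (a (t, y))) has_real_derivative -1/2 * (partial_x a (x, y) * (1 / sqrt (a (x, y))) ^ 3)) (at x)"
    by (rule d[OF partial_x_DERIV[OF a_smooth_Suc xy] pos])
  show "((\<lambda>t. 1 / sqrt (a (x, t))) has_real_derivative -1/2 * (partial_y a (x, y) * (1 / sqrt (a (x, y))) ^ 3)) (at y)"
    by (rule d[OF partial_y_DERIV[OF a_smooth_Suc xy] pos])
qed

text \<open>The gradient of the root contains a negative power of it, so the bootstrap is run for
  \<open>1 / sqrt a\<close> and the root is recovered as \<open>a * (1 / sqrt a)\<close>.\<close>

lemma sqrt_smooth: "smooth 6 (\<lambda>w. sqrt (a w))"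
  by (rule smooth_cong[OF _ smooth_mult[OF a_smooth inverse_sqrt_smooth]])
    (simp add: real_div_sqrt a_pos less_imp_le)

lemma log_gradient_smooth:
  "smooth 5 (\<lambda>w. partial_x a w / a w)" "smooth 5 (\<lambda>w. partial_y a w / a w)"
proof -
  have "smooth 5 (\<lambda>w. 1 / a w)"
    using inverse_smooth by (rule partials_upto_le) simp
  thus "smooth 5 (\<lambda>w. partial_x a w / a w)" "smooth 5 (\<lambda>w. partial_y a w / a w)"
    using smooth_mult[of 5 "partial_x a" "\<lambda>w. 1 / a w"] smooth_mult[of 5 "partial_y a" "\<lambda>w. 1 / a w"]
      partials_upto_partial_x[OF a_smooth_Suc] partials_upto_partial_y[OF a_smooth_Suc] by simp_all
qed

text \<open>The first two claims are the gradient formula for the root. In the third, coefficients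
  of \<open>lap \<beta>\<close> of order 5 involve jets of order 7, beyond the regularity of
  \<open>a\<close>. With \<open>Q\<close> built from this same formal Laplacian, the claim follows
  from \<open>1 / sqrt a * sqrt a = 1\<close>, whatever those jets are.\<close>

lemma sqrt_conjugation:
  defines "\<beta> \<equiv> series (\<lambda>w. sqrt (a w))"
  defines "Q \<equiv> series (\<lambda>w. 1 / sqrt (a w)) * lap \<beta>"
  shows "vanish 6 (egf (jet S z (\<lambda>w. partial_x a w / a w)) * \<beta> - (dx \<beta> + dx \<beta>))"
    and "vanish 6 (egf (jet S z (\<lambda>w. partial_y a w / a w)) * \<beta> - (dy \<beta> + dy \<beta>))"
    and "vanish 6 (Q * \<beta> - lap \<beta>)" and "cf \<beta> 0 0 > 0"
proof -
  let ?b = "\<lambda>w. sqrt (a w)"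
  have b6: "smooth (Suc 5) ?b" using sqrt_smooth by simp
  have b5: "smooth 5 ?b" using sqrt_smooth by (rule partials_upto_le) simp
  have d: "((\<lambda>t. sqrt (g t)) has_real_derivative D / (2 * sqrt (g s))) (at s)"
    if "(g has_real_derivative D) (at s)" "g s > 0" for g D s
    using that by (auto intro!: derivative_eq_intros simp: field_simps)
  have grad: "partial_x a p / a p * ?b p = partial_x ?b p + partial_x ?b p"
    "partial_y a p / a p * ?b p = partial_y ?b p + partial_y ?b p" if "p \<in> S" for p
  proof -
    obtain x y where p: "p = (x, y)" by (cases p)
    have xy: "(x, y) \<in> S" and pos: "a (x, y) > 0" using that p a_pos by auto
    have halves: "D / a (x, y) * ?b (x, y) = D / (2 * ?b (x, y)) + D / (2 * ?b (x, y))" for D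
    proof -
      have "D / (s * s) * s = D / (2 * s) + D / (2 * s)" if "s > 0" for s :: real
        using that by (simp add: field_simps)
      from this[of "?b (x, y)"] show ?thesis using pos by simp
    qed
    have "partial_x ?b (x, y) = partial_x a (x, y) / (2 * ?b (x, y))"
      "partial_y ?b (x, y) = partial_y a (x, y) / (2 * ?b (x, y))"
      by (rule partial_x_eqI d[OF partial_x_DERIV[OF a_smooth_Suc xy] pos]
          partial_y_eqI d[OF partial_y_DERIV[OF a_smooth_Suc xy] pos])+
    thus "partial_x a p / a p * ?b p = partial_x ?b p + partial_x ?b p"
      "partial_y a p / a p * ?b p = partial_y ?b p + partial_y ?b p"
      unfolding p halves by simp_all
  qed
  have "agree (Suc 5) (series (\<lambda>w. partial_x a w / a w) * \<beta>) (series (\<lambda>p. partial_x a p / a p * ?b p))"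
    unfolding \<beta>_def by (rule agree_sym[OF series_mult[OF log_gradient_smooth(1) b5]])
  also have "series (\<lambda>p. partial_x a p / a p * ?b p) = series (\<lambda>p. partial_x ?b p + partial_x ?b p)"
    by (rule series_cong) (rule grad)
  also have "agree (Suc 5) \<dots> (series (partial_x ?b) + series (partial_x ?b))"
    by (intro series_add partials_upto_partial_x b6)
  also have "agree (Suc 5) \<dots> (dx \<beta> + dx \<beta>)"
    unfolding \<beta>_def by (intro agree_add agree_sym[OF dx_series] b6)
  finally show "vanish 6 (egf (jet S z (\<lambda>w. partial_x a w / a w)) * \<beta> - (dx \<beta> + dx \<beta>))"
    by (simp add: agree_def series_def)
  have "agree (Suc 5) (series (\<lambda>w. partial_y a w / a w) * \<beta>) (series (\<lambda>p. partial_y a p / a p * ?b p))"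
    unfolding \<beta>_def by (rule agree_sym[OF series_mult[OF log_gradient_smooth(2) b5]])
  also have "series (\<lambda>p. partial_y a p / a p * ?b p) = series (\<lambda>p. partial_y ?b p + partial_y ?b p)"
    by (rule series_cong) (rule grad)
  also have "agree (Suc 5) \<dots> (series (partial_y ?b) + series (partial_y ?b))"
    by (intro series_add partials_upto_partial_y b6)
  finally show "vanish 6 (egf (jet S z (\<lambda>w. partial_y a w / a w)) * \<beta> - (dy \<beta> + dy \<beta>))"
    by (simp add: agree_def series_def \<beta>_def dy_series[unfolded series_def])
  have "agree (Suc 6) (series (\<lambda>w. 1 / sqrt (a w)) * \<beta>) (series (\<lambda>p. 1 / sqrt (a p) * ?b p))"
    unfolding \<beta>_def by (rule agree_sym[OF series_mult[OF inverse_sqrt_smooth sqrt_smooth]])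
  also have "series (\<lambda>p. 1 / sqrt (a p) * ?b p) = series (\<lambda>_. 1)"
    by (rule series_cong) (use a_pos in force)
  also have "\<dots> = 1"
    by (simp add: series_const)
  finally have "agree 6 (series (\<lambda>w. 1 / sqrt (a w)) * \<beta>) 1"
    by (rule agree_mono) simp
  hence "agree 6 (series (\<lambda>w. 1 / sqrt (a w)) * \<beta> * lap \<beta>) (1 * lap \<beta>)"
    by (intro agree_mult agree_refl)
  thus "vanish 6 (Q * \<beta> - lap \<beta>)"
    by (simp add: agree_def Q_def mult_ac)
  have "(?b \<longlongrightarrow> sqrt (one_sided S a z)) (at z within S)"
    by (intro tendsto_intros tendsto_one_sided a_extendable)
  hence "one_sided S ?b z = sqrt (one_sided S a z)"
    by (intro one_sided_eq partials_upto_base[OF sqrt_smooth])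
  thus "cf \<beta> 0 0 > 0"
    using a_pos_z by (simp add: \<beta>_def cf_series_0_0)
qed

context
  fixes u f :: "real \<times> real \<Rightarrow> real"
  assumes u_smooth: "smooth 7 u" and f_smooth: "smooth 5 f"
    and pde: "\<And>p. p \<in> S \<Longrightarrow> elliptic_op a u p = f p"
begin

text \<open>After division by \<open>a\<close> every term is a function of regularity 5, so its jets
  are meaningful up to order 5, that is modulo order 6.\<close>

lemma series_pde:
  "vanish 6 (elim_op (series (\<lambda>w. partial_x a w / a w)) (series (\<lambda>w. partial_y a w / a w)) (series u)
     + series (\<lambda>w. 1 / a w) * series f)"
proof -
  let ?rx = "\<lambda>w. partial_x a w / a w" and ?ry = "\<lambda>w. partial_y a w / a w" and ?r = "\<lambda>w. 1 / a w"
  have u7: "smooth (Suc 6) u" and u7': "smooth (Suc (Suc 5)) u" using u_smooth by simp_all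
  have ux6: "smooth (Suc 5) (partial_x u)" and uy6: "smooth (Suc 5) (partial_y u)"
    by (rule partials_upto_partial_x[OF u7'] partials_upto_partial_y[OF u7'])+
  have uxx: "smooth 5 (partial_x (partial_x u))" and uyy: "smooth 5 (partial_y (partial_y u))"
    and ux: "smooth 5 (partial_x u)" and uy: "smooth 5 (partial_y u)"
    by (rule partials_upto_partial_x[OF ux6] partials_upto_partial_y[OF uy6]
        partials_upto_Suc_imp[OF ux6] partials_upto_Suc_imp[OF uy6])+
  have r: "smooth 5 ?r" using inverse_smooth by (rule partials_upto_le) simp
  have zero: "(partial_x (partial_x u) p + partial_y (partial_y u) p) + (?rx p * partial_x u p + ?ry p * partial_y u p)
      + ?r p * f p = 0" if "p \<in> S" for p
  proof -
    have "f p = - (partial_x a p * partial_x u p + partial_x (partial_x u) p * a p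
        + (partial_y a p * partial_y u p + partial_y (partial_y u) p * a p))"
      using pde[OF that] partial_mult(1)[OF a_smooth_Suc ux6 that] partial_mult(2)[OF a_smooth_Suc uy6 that]
      by (simp add: elliptic_op_def)
    thus ?thesis using a_pos[OF that] by (simp add: field_simps)
  qed
  have dxx: "agree 6 (dx (dx (series u))) (series (partial_x (partial_x u)))"
  proof -
    have "agree (Suc 6) (dx (series u)) (series (partial_x u))"
      using u7 by (intro dx_series) simp
    hence "agree 6 (dx (dx (series u))) (dx (series (partial_x u)))"
      by (rule agree_dx)
    also have "agree 6 \<dots> (series (partial_x (partial_x u)))"
      using ux6 by (intro dx_series) simp
    finally show ?thesis .
  qed
  have dx1: "agree 6 (dx (series u)) (series (partial_x u))"
    using u7 by (intro agree_mono[OF dx_series]) auto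
  have prod: "agree 6 (series (\<lambda>p. ?rx p * partial_x u p)) (series ?rx * series (partial_x u))"
    "agree 6 (series (\<lambda>p. ?ry p * partial_y u p)) (series ?ry * series (partial_y u))"
    "agree 6 (series (\<lambda>p. ?r p * f p)) (series ?r * series f)"
    using series_mult[OF log_gradient_smooth(1) ux] series_mult[OF log_gradient_smooth(2) uy]
      series_mult[OF r f_smooth] by simp_all
  have add: "agree 6 (series (\<lambda>p. g p + h p)) (series g + series h)" if "smooth 5 g" "smooth 5 h" for g h
    using series_add[OF that] by simp
  \<comment> \<open>The series of the separate terms are merged into the series of one function,
    which is zero on \<open>S\<close>.\<close>
  have "agree 6 (elim_op (series ?rx) (series ?ry) (series u) + series ?r * series f)
     ((series (partial_x (partial_x u)) + series (partial_y (partial_y u)))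
      + (series (\<lambda>p. ?rx p * partial_x u p) + series (\<lambda>p. ?ry p * partial_y u p)) + series (\<lambda>p. ?r p * f p))"
    unfolding elim_op_def lap_def dy_series add.assoc[of _ "series ?rx * _"]
    by (intro agree_add dxx agree_refl prod[THEN agree_sym]
        agree_trans[OF agree_mult[OF agree_refl dx1] agree_sym[OF prod(1)]])
  also have "agree 6 \<dots> ((series (\<lambda>p. partial_x (partial_x u) p + partial_y (partial_y u) p))
      + series (\<lambda>p. ?rx p * partial_x u p + ?ry p * partial_y u p) + series (\<lambda>p. ?r p * f p))"
    by (intro agree_add agree_refl add[THEN agree_sym] uxx uyy smooth_mult log_gradient_smooth ux uy)
  also have "agree 6 \<dots> (series (\<lambda>p. (partial_x (partial_x u) p + partial_y (partial_y u) p)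
      + (?rx p * partial_x u p + ?ry p * partial_y u p)) + series (\<lambda>p. ?r p * f p))"
    by (intro agree_add agree_refl add[THEN agree_sym] uxx uyy smooth_add smooth_mult log_gradient_smooth ux uy)
  also have "agree 6 \<dots> (series (\<lambda>p. (partial_x (partial_x u) p + partial_y (partial_y u) p)
      + (?rx p * partial_x u p + ?ry p * partial_y u p) + ?r p * f p))"
    by (intro add[THEN agree_sym] uxx uyy smooth_add smooth_mult log_gradient_smooth ux uy r f_smooth)
  also have "\<dots> = series (\<lambda>_. 0)"
    by (rule series_cong) (rule zero)
  also have "\<dots> = 0"
    by (simp add: series_const)
  finally show ?thesis
    by (simp add: agree_def)
qed

text \<open>Superposition replaces the repeated elimination: \<open>U\<close> carries the Cauchy
  data of \<open>u\<close> and \<open>F\<close> the jets of \<open>f\<close>. Their sum has the data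
  of \<open>u\<close> and solves its equation modulo order 6, so uniqueness applies.\<close>

lemma jet_u_expansion:
  assumes "p + q \<le> 7"
  shows "jet S z u p q = (\<Sum>(m, n)\<in>Lam1 7. jet S z u m n * coef_u S a z p q m n)
    + (\<Sum>(m, n)\<in>Lam 5. jet S z f m n * coef_f S a z p q m n)"
proof -
  define R1 where "R1 = series (\<lambda>w. partial_x a w / a w)"
  define R2 where "R2 = series (\<lambda>w. partial_y a w / a w)"
  define A where "A = series (\<lambda>w. 1 / a w)"
  define \<delta> where "\<delta> = (\<lambda>m n. egf (\<lambda>p q. if (m, n) = (p, q) then 1 else 0))"
  define U where "U = (\<Sum>(m, n)\<in>Lam1 7. smult2 (jet S z u m n) (fund_u S a z m n))"
  define F where "F = (\<Sum>(m, n)\<in>Lam 5. smult2 (jet S z f m n) (fund_f S a z m n))"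
  have "elim_op R1 R2 U = 0"
    unfolding U_def elim_op_sum
    by (intro sum.neutral ballI)
      (auto simp: elim_op_smult2 R1_def R2_def series_def elim_op_fund_u, auto simp: smult2_def)
  moreover have "elim_op R1 R2 F = - (A * (\<Sum>(m, n)\<in>Lam 5. smult2 (jet S z f m n) (\<delta> m n)))"
  proof -
    have "elim_op R1 R2 (smult2 x (fund_f S a z m n)) = - (A * smult2 x (\<delta> m n))" for x m n
    proof -
      have "elim_op R1 R2 (fund_f S a z m n) = - (A * \<delta> m n)"
        using elim_op_fund_f[of S z a m n]
        by (simp add: R1_def R2_def A_def \<delta>_def series_def eq_neg_iff_add_eq_0)
      thus ?thesis by (simp add: elim_op_smult2) (simp add: smult2_def mult_ac)
    qed
    thus ?thesis
      unfolding F_def elim_op_sum sum_distrib_left sum_negf[symmetric]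
      by (intro sum.cong refl) auto
  qed
  \<comment> \<open>The residual is that of \<open>u\<close> itself plus the part of
    \<open>f\<close> of order at least 6, which the sum over \<open>Lam 5\<close> misses.\<close>
  ultimately have "elim_op R1 R2 (series u - U - F) = (elim_op R1 R2 (series u) + A * series f)
      - A * (series f - (\<Sum>(m, n)\<in>Lam 5. smult2 (jet S z f m n) (\<delta> m n)))"
    by (simp add: elim_op_diff elim_op_add algebra_simps)
  moreover have "vanish 6 (series f - (\<Sum>(m, n)\<in>Lam 5. smult2 (jet S z f m n) (\<delta> m n)))"
  proof -
    have "cf (\<Sum>(m, n)\<in>Lam 5. smult2 (jet S z f m n) (\<delta> m n)) i j = cf (series f) i j" if "i + j < 6" for i j
    proof -
      have "cf (\<Sum>(m, n)\<in>Lam 5. smult2 (jet S z f m n) (\<delta> m n)) i j =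
          (\<Sum>mn\<in>Lam 5. if mn = (i, j) then jet S z f i j / (fact i * fact j) else 0)"
        unfolding cf_sum by (intro sum.cong refl) (auto simp: \<delta>_def split: if_splits)
      also have "(\<Sum>mn\<in>Lam 5. if mn = (i, j) then jet S z f i j / (fact i * fact j) else 0) =
          jet S z f i j / (fact i * fact j)"
      proof -
        have "(i, j) \<in> Lam 5" using that by (simp add: Lam_def)
        thus ?thesis by simp
      qed
      finally show ?thesis by (simp add: series_def)
    qed
    thus ?thesis by (simp add: vanish_def)
  qed
  ultimately have "vanish 6 (elim_op R1 R2 (series u - U - F))"
    using series_pde by (simp add: R1_def R2_def A_def vanish_diff vanish_mult_right)
  moreover have cfU: "cf U i j * (fact i * fact j) = (\<Sum>(m, n)\<in>Lam1 7. jet S z u m n * coef_u S a z i j m n)" for i j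
    unfolding U_def cf_sum sum_distrib_right by (intro sum.cong refl) (auto simp: fund_u_def)
  moreover have cfF: "cf F i j * (fact i * fact j) = (\<Sum>(m, n)\<in>Lam 5. jet S z f m n * coef_f S a z i j m n)" for i j
    unfolding F_def cf_sum sum_distrib_right by (intro sum.cong refl) (auto simp: fund_f_def)
  moreover have "cf (series u - U - F) i j = 0" if "i \<le> 1" "i + j < 8" for i j
  proof -
    have "(\<Sum>(m, n)\<in>Lam1 7. jet S z u m n * coef_u S a z i j m n) =
        (\<Sum>mn\<in>Lam1 7. if mn = (i, j) then jet S z u i j else 0)"
      using that by (intro sum.cong refl) (auto simp: coef_u_initial split: if_splits)
    also have "\<dots> = jet S z u i j"
    proof -
      have "(i, j) \<in> Lam1 7" using that by (auto simp: Lam1_def Lam_def)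
      thus ?thesis by simp
    qed
    finally have "cf U i j * (fact i * fact j) = jet S z u i j" by (simp add: cfU)
    moreover have "cf F i j * (fact i * fact j) = 0"
      unfolding cfF using that by (simp add: coef_f_initial)
    ultimately have "cf U i j = cf (series u) i j" "cf F i j = 0"
      by (auto simp: series_def field_simps)
    thus ?thesis by simp
  qed
  ultimately have "vanish 8 (series u - U - F)"
    by (intro elim_op_unique)
  hence "cf (series u) p q * (fact p * fact q) = cf U p q * (fact p * fact q) + cf F p q * (fact p * fact q)"
    using assms by (simp add: vanish_def algebra_simps)
  thus ?thesis
    unfolding cfU cfF by (simp add: series_def)
qed

end

end

end

section \<open>Consistency\<close>

text \<open>The expression is a polynomial in \<open>h\<close>. Both factors are truncated after
  order 7, which does not affect coefficients of the product below order 8; there they are those of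
  the formal series in \<open>linear_system_iff\<close>.\<close>

lemma stencil_fund_u_bigo:
  assumes "linear_system S a z c" "(m, n) \<in> Lam1 7"
  shows "(\<lambda>h. \<Sum>k\<in>{-1..1}. \<Sum>l\<in>{-1..1}. stencil_coef c h k l *
      (\<Sum>(p, q)\<in>Lam 7. coef_u S a z p q m n * ((of_int k * h) ^ p * (of_int l * h) ^ q / (fact p * fact q))))
    \<in> O[at_right 0](\<lambda>h. h ^ 8)"
proof -
  define e where "e = (\<lambda>k l. fps_nth (ev (of_int k) (of_int l) (fund_u S a z m n)))"
  define C where "C = (\<lambda>k l. \<Sum>p\<in>{0..7}. monom (c k l p) p)"
  define E where "E = (\<lambda>k l. \<Sum>N\<in>{0..7}. monom (e k l N) N)"
  define P where "P = (\<Sum>k\<in>{-1..1}. \<Sum>l\<in>{-1..1}. C k l * E k l)"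
  have C: "poly (C k l) h = stencil_coef c h k l" for k l h
    by (simp add: C_def stencil_coef_def poly_sum poly_monom)
  have E: "poly (E k l) h = (\<Sum>(p, q)\<in>Lam 7. coef_u S a z p q m n *
      ((of_int k * h) ^ p * (of_int l * h) ^ q / (fact p * fact q)))" for k l h
  proof -
    have "poly (E k l) h = (\<Sum>N\<in>{0..7}. \<Sum>p\<in>{0..N}. coef_u S a z p (N - p) m n *
        ((of_int k * h) ^ p * (of_int l * h) ^ (N - p) / (fact p * fact (N - p))))"
      unfolding E_def e_def poly_sum poly_monom ev_nth sum_distrib_right
    proof (intro sum.cong refl)
      fix N p :: nat assume "p \<in> {0..N}"
      hence "h ^ N = h ^ p * h ^ (N - p)" by (simp add: power_add[symmetric])
      thus "cf (fund_u S a z m n) p (N - p) * of_int k ^ p * of_int l ^ (N - p) * h ^ N =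
          coef_u S a z p (N - p) m n * ((of_int k * h) ^ p * (of_int l * h) ^ (N - p) / (fact p * fact (N - p)))"
        by (simp add: fund_u_def power_mult_distrib)
    qed
    also have "\<dots> = (\<Sum>(N, p)\<in>(SIGMA N:{0..7}. {0..N}). coef_u S a z p (N - p) m n *
        ((of_int k * h) ^ p * (of_int l * h) ^ (N - p) / (fact p * fact (N - p))))"
      by (simp add: sum.Sigma)
    also have "\<dots> = (\<Sum>(p, q)\<in>Lam 7. coef_u S a z p q m n *
        ((of_int k * h) ^ p * (of_int l * h) ^ q / (fact p * fact q)))"
      by (rule sum.reindex_bij_witness[where i = "\<lambda>(p, q). (p + q, p)" and j = "\<lambda>(N, p). (p, N - p)"])
        (auto simp: Lam_def)
    finally show ?thesis .
  qed
  have "coeff P N = 0" if "N < 8" for N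
  proof -
    have C': "coeff (C k l) s = c k l s" if "s \<le> N" for k l s
      using that \<open>N < 8\<close> by (simp add: C_def coeff_sum)
    have E': "coeff (E k l) s = e k l s" if "s \<le> N" for k l s
      using that \<open>N < 8\<close> by (simp add: E_def coeff_sum)
    have "coeff P N = (\<Sum>k\<in>{-1..1}. \<Sum>l\<in>{-1..1}. \<Sum>s\<le>N. c k l s * e k l (N - s))"
      by (simp add: P_def coeff_sum coeff_mult C' E')
    also have "\<dots> = fps_nth (\<Sum>k\<in>{-1..1}. \<Sum>l\<in>{-1..1}.
        Abs_fps (c k l) * ev (of_int k) (of_int l) (fund_u S a z m n)) N"
      by (simp add: e_def fps_sum_nth fps_mult_nth atLeast0AtMost)
    also have "\<dots> = 0"
      using assms that by (auto simp: linear_system_iff)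
    finally show ?thesis .
  qed
  hence "poly P \<in> O[at_right 0](\<lambda>h. h ^ 8)"
    by (rule poly_bigo_at_right_0)
  also have "poly P = (\<lambda>h. \<Sum>k\<in>{-1..1}. \<Sum>l\<in>{-1..1}. stencil_coef c h k l *
      (\<Sum>(p, q)\<in>Lam 7. coef_u S a z p q m n * ((of_int k * h) ^ p * (of_int l * h) ^ q / (fact p * fact q))))"
    by (simp add: P_def poly_sum C E fun_eq_iff)
  finally show ?thesis .
qed

lemma stencil_coef_bigo: "(\<lambda>h. stencil_coef c h k l) \<in> O[at_right 0](\<lambda>_. 1)"
proof -
  have "poly (\<Sum>p\<in>{0..7}. monom (c k l p) p) \<in> O[at_right 0](\<lambda>h. h ^ 0)"
    by (rule poly_bigo_at_right_0) simp
  moreover have "poly (\<Sum>p\<in>{0..7}. monom (c k l p) p) = (\<lambda>h. stencil_coef c h k l)"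
    by (simp add: stencil_coef_def poly_sum poly_monom fun_eq_iff)
  ultimately show ?thesis by simp
qed

lemma H7_poly_eq:
  "H7_poly S a z m n x y = (\<Sum>(p, q)\<in>Lam 7. coef_f S a z p q m n * (x ^ p * y ^ q / (fact p * fact q)))"
  unfolding H7_poly_def
  by (rule sum.mono_neutral_cong_left)
    (auto simp: Lam2_def Lam1_def coef_f_initial)

text \<open>The \<open>f\<close> part of the Taylor polynomial cancels exactly against the
  right-hand side. What is left is the Taylor remainder and a fixed combination of the homogeneous
  solutions, both of order 8 before the division by \<open>h^2\<close>.\<close>

lemma sixth_order_consistentI:
  assumes ls: "linear_system S a z c" and taylor: "taylor_at_stencil S u U z"
    and jets: "\<And>p q. p + q \<le> 7 \<Longrightarrow>
      jet S z u p q = (\<Sum>(m, n)\<in>Lam1 7. jet S z u m n * coef_u S a z p q m n)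
        + (\<Sum>(m, n)\<in>Lam 5. jet S z f m n * coef_f S a z p q m n)"
  shows "sixth_order_consistent S a f U z c"
proof -
  define w where "w = (\<lambda>h k l p q. (of_int k * h) ^ p * (of_int l * h) ^ q / (fact p * fact q) :: real)"
  define T where "T = (\<lambda>h k l. \<Sum>(p, q)\<in>Lam 7. jet S z u p q * w h k l p q)"
  define V where "V = (\<lambda>h k l m n. \<Sum>(p, q)\<in>Lam 7. coef_u S a z p q m n * w h k l p q)"
  define H where "H = (\<lambda>h k l m n. \<Sum>(p, q)\<in>Lam 7. coef_f S a z p q m n * w h k l p q)"
  have T: "T h k l = (\<Sum>(m, n)\<in>Lam1 7. jet S z u m n * V h k l m n) + (\<Sum>(m, n)\<in>Lam 5. jet S z f m n * H h k l m n)"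
    for h k l
  proof -
    have "T h k l = (\<Sum>(p, q)\<in>Lam 7. (\<Sum>(m, n)\<in>Lam1 7. jet S z u m n * coef_u S a z p q m n * w h k l p q)
        + (\<Sum>(m, n)\<in>Lam 5. jet S z f m n * coef_f S a z p q m n * w h k l p q))"
      unfolding T_def
      by (intro sum.cong refl)
        (auto simp: Lam_def jets distrib_right sum_distrib_right case_prod_unfold)
    also have "\<dots> = (\<Sum>(m, n)\<in>Lam1 7. jet S z u m n * V h k l m n) + (\<Sum>(m, n)\<in>Lam 5. jet S z f m n * H h k l m n)"
      unfolding V_def H_def case_prod_unfold sum.distrib sum_distrib_left
      by (subst sum.swap, subst (2) sum.swap) (simp add: mult.assoc)
    finally show ?thesis .
  qed
  have "(\<lambda>h. 1 / h\<^sup>2 * ((\<Sum>k\<in>{-1..1}. \<Sum>l\<in>{-1..1}. stencil_coef c h k l * (U (stencil_pt z h k l) - T h k l))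
      + (\<Sum>(m, n)\<in>Lam1 7. jet S z u m n * (\<Sum>k\<in>{-1..1}. \<Sum>l\<in>{-1..1}. stencil_coef c h k l * V h k l m n))))
      \<in> O[at_right 0](\<lambda>h. 1 / h\<^sup>2 * h ^ 8)"
  proof (intro landau_o.big.mult sum_in_bigo)
    show "(\<lambda>h. \<Sum>k\<in>{-1..1}. \<Sum>l\<in>{-1..1}. stencil_coef c h k l * (U (stencil_pt z h k l) - T h k l))
      \<in> O[at_right 0](\<lambda>h. h ^ 8)"
    proof (intro big_sum_in_bigo)
      fix k l :: int assume "k \<in> {-1..1}" "l \<in> {-1..1}"
      hence "(\<lambda>h. U (stencil_pt z h k l) - T h k l) \<in> O[at_right 0](\<lambda>h. h ^ 8)"
        using taylor unfolding taylor_at_stencil_def T_def w_def by blast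
      from landau_o.big.mult[OF stencil_coef_bigo[of c k l] this]
      show "(\<lambda>h. stencil_coef c h k l * (U (stencil_pt z h k l) - T h k l)) \<in> O[at_right 0](\<lambda>h. h ^ 8)"
        by simp
    qed
    show "(\<lambda>h. \<Sum>(m, n)\<in>Lam1 7. jet S z u m n * (\<Sum>k\<in>{-1..1}. \<Sum>l\<in>{-1..1}. stencil_coef c h k l * V h k l m n))
      \<in> O[at_right 0](\<lambda>h. h ^ 8)"
      using stencil_fund_u_bigo[OF ls] unfolding V_def w_def
      by (intro big_sum_in_bigo) (auto intro!: landau_o.big.mult_in_1 simp: case_prod_unfold)
  qed auto
  also have "(\<lambda>h. 1 / h\<^sup>2 * ((\<Sum>k\<in>{-1..1}. \<Sum>l\<in>{-1..1}. stencil_coef c h k l * (U (stencil_pt z h k l) - T h k l))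
      + (\<Sum>(m, n)\<in>Lam1 7. jet S z u m n * (\<Sum>k\<in>{-1..1}. \<Sum>l\<in>{-1..1}. stencil_coef c h k l * V h k l m n)))) =
      (\<lambda>h. scheme_lhs c h (\<lambda>k l. U (stencil_pt z h k l)) - scheme_rhs S a f z c h)"
  proof
    fix h
    have "(\<Sum>k\<in>{-1..1}. \<Sum>l\<in>{-1..1}. stencil_coef c h k l * T h k l) =
        (\<Sum>(m, n)\<in>Lam1 7. jet S z u m n * (\<Sum>k\<in>{-1..1}. \<Sum>l\<in>{-1..1}. stencil_coef c h k l * V h k l m n))
        + (\<Sum>(m, n)\<in>Lam 5. jet S z f m n * (\<Sum>k\<in>{-1..1}. \<Sum>l\<in>{-1..1}. stencil_coef c h k l * H h k l m n))"
      unfolding T sum_unit_range case_prod_unfold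
      by (simp add: distrib_left sum.distrib sum_distrib_left mult.left_commute)
    moreover have "H7_poly S a z m n (of_int k * h) (of_int l * h) = H h k l m n" for k l m n
      by (simp add: H7_poly_eq H_def w_def)
    ultimately show "1 / h\<^sup>2 * ((\<Sum>k\<in>{-1..1}. \<Sum>l\<in>{-1..1}. stencil_coef c h k l * (U (stencil_pt z h k l) - T h k l))
      + (\<Sum>(m, n)\<in>Lam1 7. jet S z u m n * (\<Sum>k\<in>{-1..1}. \<Sum>l\<in>{-1..1}. stencil_coef c h k l * V h k l m n))) =
      scheme_lhs c h (\<lambda>k l. U (stencil_pt z h k l)) - scheme_rhs S a f z c h"
      by (simp add: scheme_lhs_def scheme_rhs_def right_diff_distrib sum_subtractf)
  qed
  also have "O[at_right 0](\<lambda>h::real. 1 / h\<^sup>2 * h ^ 8) = O[at_right 0](\<lambda>h. h ^ 6)"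
    by (rule landau_o.big.cong)
      (auto simp: eventually_at_filter power_numeral_reduce divide_simps)
  finally show ?thesis
    unfolding sixth_order_consistent_def .
qed

theorem theorem2p1:
  fixes l1 l2 l3 l4 h0 :: real
    and N0 N1 i j :: nat
    and \<psi> a u f U :: "real \<times> real \<Rightarrow> real"
    and \<Omega> S :: "(real \<times> real) set"
    and z :: "real \<times> real"
    and s :: side
  assumes "l1 < l2" and "0 < N0" and "l4 - l3 = of_nat N0 * (l2 - l1)"
    and \<Omega>_eq: "\<Omega> = rect l1 l2 l3 l4"
    and psi_smooth: "smooth2 \<psi>"
    and curve: "smooth_curve (interface \<Omega> \<psi>)"
    and a_pos: "\<And>r p. p \<in> \<Omega> \<Longrightarrow> p \<in> closure (subdomain \<Omega> \<psi> r) \<Longrightarrow>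
                  one_sided (subdomain \<Omega> \<psi> r) a p > 0"
    and a_reg: "\<And>r. uc_partials 6 (subdomain \<Omega> \<psi> r) a"
    and u_reg: "\<And>r. uc_partials 7 (subdomain \<Omega> \<psi> r) u"
    and f_reg: "\<And>r. uc_partials 5 (subdomain \<Omega> \<psi> r) f"
    and pde: "\<And>p. p \<in> \<Omega> - interface \<Omega> \<psi> \<Longrightarrow> elliptic_op a u p = f p"
    and grid: "0 < N1" "i \<le> N1" "j \<le> N0 * N1"
    and h0_eq: "h0 = (l2 - l1) / of_nat N1"
    and z_eq: "z = (l1 + of_nat i * h0, l3 + of_nat j * h0)"
    and interior: "z \<notin> frontier \<Omega>"
    and regular: "regular_on_side \<psi> s z h0"
    and S_eq: "S = subdomain \<Omega> \<psi> s"
    and z_closure: "z \<in> closure S"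
    and U_side: "side_solution \<Omega> \<psi> s u U"
    and taylor: "taylor_at_stencil S u U z"
  shows "(\<forall>c. linear_system S a z c \<and> nontrivial c \<longrightarrow>
            sixth_order_consistent S a f U z c) \<and>
         (\<exists>c. linear_system S a z c \<and> nontrivial c) \<and>
         (\<forall>c. linear_system S a z c \<and> nontrivial c \<longrightarrow>
            (\<forall>h>0. (\<Sum>k\<in>{-1..1}. \<Sum>l\<in>{-1..1}. stencil_coef c h k l) \<ge> 0)) \<and>
         (\<exists>c. linear_system S a z c \<and> nontrivial c \<and>
            (\<forall>h>0. stencil_coef c h 0 0 > 0 \<and>
               (\<forall>k\<in>{-1..1}. \<forall>l\<in>{-1..1}. (k, l) \<noteq> (0, 0) \<longrightarrow> stencil_coef c h k l \<le> 0)))"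
proof -
  define \<Omega>' where "\<Omega>' = {l1<..<l2} \<times> {l3<..<l4}"
  have \<Omega>: "\<Omega> = \<Omega>'" by (simp add: \<Omega>_eq rect_def \<Omega>'_def)
  have "open \<Omega>" by (simp add: \<Omega> \<Omega>'_def open_Times)
  have "0 < of_nat N0 * (l2 - l1)" using assms(1,2) by simp
  hence "l3 < l4" using assms(3) by linarith
  have "z \<in> \<Omega>"
  proof -
    have "0 \<le> h0" using \<open>l1 < l2\<close> by (simp add: h0_eq)
    have h0: "of_nat N1 * h0 = l2 - l1" using \<open>0 < N1\<close> by (simp add: h0_eq)
    have "of_nat i * h0 \<le> of_nat N1 * h0"
      using \<open>i \<le> N1\<close> \<open>0 \<le> h0\<close> by (intro mult_right_mono) auto
    moreover have "of_nat j * h0 \<le> of_nat (N0 * N1) * h0"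
      using \<open>j \<le> N0 * N1\<close> \<open>0 \<le> h0\<close> by (intro mult_right_mono) (simp_all only: of_nat_le_iff)
    moreover have "of_nat (N0 * N1) * h0 = l4 - l3"
      using h0 assms(3) by simp
    ultimately have "z \<in> {l1..l2} \<times> {l3..l4}"
      using h0 \<open>0 \<le> h0\<close> by (simp add: z_eq)
    hence "z \<in> closure \<Omega>"
      using \<open>l1 < l2\<close> \<open>l3 < l4\<close> by (simp add: \<Omega> \<Omega>'_def closure_Times)
    hence "z \<in> interior \<Omega>"
      using interior by (simp add: frontier_def)
    thus ?thesis using interior_subset by blast
  qed
  have "continuous_on UNIV \<psi>"
    using psi_smooth unfolding smooth2_def by (metis partials_upto.simps(1))
  hence "open {p. \<psi> p > 0}" "open {p. \<psi> p < 0}"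
    by (auto intro!: open_Collect_less continuous_intros)
  moreover have "S = \<Omega> \<inter> {p. \<psi> p > 0} \<or> S = \<Omega> \<inter> {p. \<psi> p < 0}"
    by (cases s) (auto simp: S_eq)
  ultimately have "open S"
    using \<open>open \<Omega>\<close> by auto
  then interpret boundary_point S z
    using z_closure by unfold_locales
  have S_sub: "S \<subseteq> \<Omega> - interface \<Omega> \<psi>"
    by (cases s) (auto simp: S_eq interface_def)
  have a: "smooth 6 a" and u: "smooth 7 u" and f: "smooth 5 f"
    using a_reg[of s] u_reg[of s] f_reg[of s] unfolding S_eq[symmetric] by (auto intro: uc_imp_smooth)
  \<comment> \<open>Positivity is assumed for one-sided values: on \<open>S\<close> these are the
    plain values, at \<open>z\<close> possibly a limit.\<close>
  have a_S: "a p > 0" if "p \<in> S" for p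
    using a_pos[of p s] that S_sub closure_subset[of S] by (auto simp: one_sided_def S_eq[symmetric])
  have a_z: "one_sided S a z > 0"
    using a_pos[OF \<open>z \<in> \<Omega>\<close>, of s] z_closure by (simp add: S_eq)
  have pde_S: "elliptic_op a u p = f p" if "p \<in> S" for p
    using that S_sub by (intro pde) auto
  obtain c where c: "linear_system S a z c" "nontrivial c"
    "\<And>h. h > 0 \<Longrightarrow> stencil_coef c h 0 0 > 0"
    "\<And>h k l. h > 0 \<Longrightarrow> k \<in> {-1..1} \<Longrightarrow> l \<in> {-1..1} \<Longrightarrow> (k, l) \<noteq> (0, 0) \<Longrightarrow> stencil_coef c h k l \<le> 0"
    using linear_system_solution_exists[OF sqrt_conjugation[OF a a_S a_z]] by blast
  show ?thesis
  proof (intro conjI)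
    have "sixth_order_consistent S a f U z c" if "linear_system S a z c" for c
      using that taylor jet_u_expansion[OF a a_S a_z u f pde_S] by (rule sixth_order_consistentI)
    thus "\<forall>c. linear_system S a z c \<and> nontrivial c \<longrightarrow> sixth_order_consistent S a f U z c"
      by simp
    show "\<exists>c. linear_system S a z c \<and> nontrivial c"
      using c(1,2) by blast
    have sum_nonneg: "(\<Sum>k\<in>{-1..1}. \<Sum>l\<in>{-1..1}. stencil_coef c h k l) \<ge> 0"
      if "linear_system S a z c" for c h
      using linear_system_sum_zero[OF that, of h] by simp
    show "\<forall>c. linear_system S a z c \<and> nontrivial c \<longrightarrow>
        (\<forall>h>0. (\<Sum>k\<in>{-1..1}. \<Sum>l\<in>{-1..1}. stencil_coef c h k l) \<ge> 0)"
      by (intro allI impI sum_nonneg) (elim conjE)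
    have "\<forall>h>0. stencil_coef c h 0 0 > 0 \<and>
        (\<forall>k\<in>{-1..1}. \<forall>l\<in>{-1..1}. (k, l) \<noteq> (0, 0) \<longrightarrow> stencil_coef c h k l \<le> 0)"
      by (intro allI impI conjI ballI c(3,4))
    with c(1,2) show "\<exists>c. linear_system S a z c \<and> nontrivial c \<and>
        (\<forall>h>0. stencil_coef c h 0 0 > 0 \<and>
           (\<forall>k\<in>{-1..1}. \<forall>l\<in>{-1..1}. (k, l) \<noteq> (0, 0) \<longrightarrow> stencil_coef c h k l \<le> 0))"
      by (intro exI[of _ c] conjI)
  qed
qed

end
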